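(* Let $m\ge1$ and let $a,b_1,\ldots,b_m,c,d\in\mathbb{C}$ satisfy, for $j=1,\ldots,m$, $$2a,\ a+b_j,\ a+c,\ a+d,\ 2b_j,\ b_j+c,\ b_j+d,\ 2c,\ c+d,\ 2d\notin\{0,-1,-2,\ldots\},\qquad a+b_j+c+d\notin\{0,-1,-2,\ldots\},$$ and $b_\ell-b_k\notin\mathbb{Z}$ for $\ell\neq k$. Let $\vec n=(n_1,\ldots,n_m)$ be a multi-index, $s_j=n_1+\cdots+n_j$, and $\sigma_j=a+b_j+c+d-1$. Put $C_{\vec n}=(a+c)_{|\vec n|}(a+d)_{|\vec n|}\prod_{j=1}^m(a+b_j)_{n_j}$. Then the multiple Wilson polynomial $p_{\vec n}(\cdot\,;a,\vec b,c,d)$ has the hypergeometric representations $$p_{\vec n}(t^2;a,\vec b,c,d)=C_{\vec n}\sum_{k_1=0}^{n_1}\cdots\sum_{k_m=0}^{n_m}\frac{(a-t)_{|\vec k|}(a+t)_{|\vec k|}(\sigma_1+n_1)_{|\vec k|}}{(a+c)_{|\vec k|}(a+d)_{|\vec k|}(a+b_1)_{|\vec k|}}\left[\prod_{i=1}^{m-1}\frac{(a+b_i+n_i)_{K_i}\,(\sigma_{i+1}+s_{i+1})_{K_i}}{(a+b_{i+1})_{K_i}\,(\sigma_i+s_i)_{K_i}}\right]\prod_{j=1}^m\frac{(-n_j)_{k_j}}{k_j!},$$ where $|\vec k|=k_1+\cdots+k_m$ and $K_i=k_{i+1}+\cdots+k_m$, and $$p_{\vec n}(t^2;a,\vec b,c,d)=C_{\vec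 n}\sum_{k=0}^{\infty}\frac{(a-t)_k(a+t)_k}{(a+c)_k(a+d)_k}\sum_{j=0}^{k}\frac{(c+d-1)_{k-j}}{(k-j)!}\,\frac{(1-c-d-|\vec n|)_j\prod_{i=1}^m(a+b_i+n_i)_j}{j!\,\prod_{i=1}^m(a+b_i)_j}.$$
   Context: Notation: multi-indices have nonnegative integer entries, $|\vec n|=n_1+\cdots+n_m$, $\vec n!=\prod_j n_j!$, $(x)_k=x(x+1)\cdots(x+k-1)$. In the first formula, a possible common factor $0$ arising from $(\sigma_i+s_i)_{K_i}$ in the denominator and the same Pochhammer base in the numerator (only possible if $\sigma_i=0$ and $n_1=\cdots=n_i=0$) is understood to be cancelled. The second expression (a Kampé de Fériet series) has only finitely many nonzero terms in the outer sum. Multiple Wilson polynomials: under the stated parameter conditions, $p_{\vec n}(\cdot\,;a,\vec b,c,d)$ is the (unique up to normalization) polynomial of degree $|\vec n|$ satisfying $$\int_{\mathcal{C}_j}p_{\vec n}(t^2;a,\vec b,c,d)\,t^{2k}\,w(t;a,b_j,c,d)\,dt=0,\qquad k=0,\ldots,n_j-1,\ j=1,\ldots,m,$$ with $$w(t;a,b,c,d)=\frac{\Gamma(a+t)\Gamma(a-t)\Gamma(b+t)\Gamma(b-t)\Gamma(c+t)\Gamma(c-t)\Gamma(d+t)\Gamma(d-t)}{\Gamma(2t)\Gamma(-2t)},$$ where $\mathcal{C}_j$ is the imaginary axis deformed so as to separate the increasing sequences of poles $\{a+k\},\{b_j+k\},\{c+k\},\{d+k\}$ ($k\ge0$) from the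 decreasing ones $\{-a-k\},\{-b_j-k\},\{-c-k\},\{-d-k\}$. Its normalization is fixed as follows. Let $\alpha_j=a+b_j-1$, $\beta=c+d-1$; let $$P_{\vec n}^{(\vec\alpha,\beta)}(u)=\frac{1}{\vec n!}(1-u)^{-\beta}\prod_{j=1}^m\left(u^{-\alpha_j}\frac{d^{n_j}}{du^{n_j}}u^{n_j+\alpha_j}\right)(1-u)^{|\vec n|+\beta}$$ (composition of operators applied to $(1-u)^{|\vec n|+\beta}$; the order is irrelevant) be the Jacobi-Piñeiro polynomial, let $P_\ell^{(\alpha,\beta)}(u)=\frac{(\alpha+1)_\ell}{\ell!}\,{}_2F_1(-\ell,\alpha+\beta+\ell+1;\alpha+1;u)$ be the shifted Jacobi polynomial, and let $$p_\ell(t^2;a,b,c,d)=(a+b)_\ell(a+c)_\ell(a+d)_\ell\;{}_4F_3\!\left(\left.{-\ell,\,a+b+c+d+\ell-1,\,a-t,\,a+t\atop a+b,\,a+c,\,a+d}\right|1\right)$$ be the Wilson polynomial. Writing $P_{\vec n}^{(\vec\alpha,\beta)}=\sum_{\ell=n_j}^{|\vec n|}c_{\vec n,\ell}^{(j)}P_\ell^{(\alpha_j,\beta)}$, one sets $$p_{\vec n}(t^2;a,\vec b,c,d)=\sum_{\ell=n_j}^{|\vec n|}\frac{\vec n!}{\ell!}(a+c+\ell)_{|\vec n|-\ell}(a+d+\ell)_{|\vec n|-\ell}\,c_{\vec n,\ell}^{(j)}\,p_\ell(t^2;a,b_j,c,d),$$ which does not depend on $j\in\{1,\ldots,m\}$.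 When $\Re(a)>0$ and $\Re(c+d)>0$ this is equivalent to $$p_{\vec n}(t^2;a,\vec b,c,d)=\vec n!\,\Gamma(a+c+|\vec n|)\Gamma(a+d+|\vec n|)\int_0^1P_{\vec n}^{(\vec\alpha,\beta)}(u)\,u^{a-1}(1-u)^{\beta}\,\frac{u^{-t}\;{}_2F_1(c-t,d-t;c+d;1-u)}{\Gamma(a-t)\Gamma(a+t)\Gamma(c+d)}\,du$$ for $0<|\Re(t)|<\Re(a)$. *)

theory Defs
  imports "HOL-Complex_Analysis.Complex_Analysis"
begin

text \<open>
  A vector \<open>(x\<^sub>1, \<dots>, x\<^sub>m)\<close> is a function on \<^typ>\<open>nat\<close> of which only the values on \<open>{1..m}\<close> matter.
\<close>

definition hypergeom :: "complex list \<Rightarrow> complex list \<Rightarrow> complex \<Rightarrow> complex" where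
  "hypergeom as bs z = eval_fps (fps_hypergeo as bs 1) z"

definition jacobi :: "nat \<Rightarrow> complex \<Rightarrow> complex \<Rightarrow> complex \<Rightarrow> complex" where
  "jacobi l \<alpha> \<beta> u = pochhammer (\<alpha> + 1) l / fact l *
     hypergeom [- of_nat l, \<alpha> + \<beta> + of_nat l + 1] [\<alpha> + 1] u"

text \<open>The value of the Wilson polynomial of degree \<open>l\<close> at the point \<open>t\<^sup>2\<close>:\<close>

definition wilson_sq :: "nat \<Rightarrow> complex \<Rightarrow> complex \<Rightarrow> complex \<Rightarrow> complex \<Rightarrow> complex \<Rightarrow> complex" where
  "wilson_sq l a b c d t = pochhammer (a + b) l * pochhammer (a + c) l * pochhammer (a + d) l *
     hypergeom [- of_nat l, a + b + c + d + of_nat l - 1, a - t, a + t] [a + b, a + c, a + d] 1"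


text \<open>
  The Rodrigues formula is read with principal powers; all functions occurring in it are
  holomorphic near the real interval \<open>(0,1)\<close>, and only its values there are used.
\<close>

definition rodrigues_op :: "nat \<Rightarrow> complex \<Rightarrow> (complex \<Rightarrow> complex) \<Rightarrow> complex \<Rightarrow> complex" where
  "rodrigues_op n \<alpha> f =
     (\<lambda>u. u powr (- \<alpha>) * (deriv ^^ n) (\<lambda>v. v powr (of_nat n + \<alpha>) * f v) u)"

definition jacobi_pineiro ::
  "nat \<Rightarrow> (nat \<Rightarrow> nat) \<Rightarrow> (nat \<Rightarrow> complex) \<Rightarrow> complex \<Rightarrow> complex \<Rightarrow> complex" where
  "jacobi_pineiro m n \<alpha> \<beta> u =
     1 / (\<Prod>j=1..m. fact (n j)) * (1 - u) powr (- \<beta>) *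
     foldr (\<lambda>j. rodrigues_op (n j) (\<alpha> j)) [1..<Suc m]
       (\<lambda>v. (1 - v) powr (of_nat (\<Sum>j=1..m. n j) + \<beta>)) u"

text \<open>
  The coefficients \<open>c\<^sub>n\<^sub>,\<^sub>l\<^sup>(\<^sup>j\<^sup>)\<close>, as a function of \<open>l\<close>, extended by zero outside the range
  \<open>n\<^sub>j \<le> l \<le> |n|\<close>.
\<close>

definition jp_coeff ::
  "nat \<Rightarrow> (nat \<Rightarrow> nat) \<Rightarrow> (nat \<Rightarrow> complex) \<Rightarrow> complex \<Rightarrow> nat \<Rightarrow> nat \<Rightarrow> complex" where
  "jp_coeff m n \<alpha> \<beta> j = (THE C.
     (\<forall>l. l \<notin> {n j..\<Sum>i=1..m. n i} \<longrightarrow> C l = 0) \<and>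
     (\<forall>u::real. 0 < u \<and> u < 1 \<longrightarrow>
        jacobi_pineiro m n \<alpha> \<beta> (of_real u) =
          (\<Sum>l = n j..\<Sum>i=1..m. n i. C l * jacobi l (\<alpha> j) \<beta> (of_real u))))"

definition wilson_expansion ::
  "nat \<Rightarrow> (nat \<Rightarrow> nat) \<Rightarrow> complex \<Rightarrow> (nat \<Rightarrow> complex) \<Rightarrow> complex \<Rightarrow> complex \<Rightarrow> nat \<Rightarrow> complex \<Rightarrow> complex" where
  "wilson_expansion m n a b c d j t =
     (let N = (\<Sum>i=1..m. n i) in
      \<Sum>l = n j..N.
        (\<Prod>i=1..m. fact (n i)) / fact l *
        pochhammer (a + c + of_nat l) (N - l) * pochhammer (a + d + of_nat l) (N - l) *
        jp_coeff m n (\<lambda>i. a + b i - 1) (c + d - 1) j l *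
        wilson_sq l a (b j) c d t)"

definition wilson_normalized ::
  "nat \<Rightarrow> (nat \<Rightarrow> nat) \<Rightarrow> complex \<Rightarrow> (nat \<Rightarrow> complex) \<Rightarrow> complex \<Rightarrow> complex \<Rightarrow> complex poly \<Rightarrow> bool" where
  "wilson_normalized m n a b c d p \<longleftrightarrow>
     (\<forall>j\<in>{1..m}. \<forall>t. poly p (t\<^sup>2) = wilson_expansion m n a b c d j t)"

text \<open>
  The multiple Wilson polynomial. Its normalization, namely that the expansion of index \<open>j\<close> holds
  for every \<open>j\<close>, already determines it completely. See below for the orthogonality relations.
\<close>

definition multiple_wilson ::
  "nat \<Rightarrow> (nat \<Rightarrow> nat) \<Rightarrow> complex \<Rightarrow> (nat \<Rightarrow> complex) \<Rightarrow> complex \<Rightarrow> complex \<Rightarrow> complex poly" where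
  "multiple_wilson m n a b c d = (THE p. wilson_normalized m n a b c d p)"


text \<open>
  The Gamma functions in the denominator are written with \<^const>\<open>rGamma\<close>, which is zero at their
  poles.
\<close>

definition wilson_weight :: "complex \<Rightarrow> complex \<Rightarrow> complex \<Rightarrow> complex \<Rightarrow> complex \<Rightarrow> complex" where
  "wilson_weight a b c d t =
     Gamma (a + t) * Gamma (a - t) * Gamma (b + t) * Gamma (b - t) *
     Gamma (c + t) * Gamma (c - t) * Gamma (d + t) * Gamma (d - t) *
     rGamma (2 * t) * rGamma (- 2 * t)"

text \<open>
  The imaginary axis, traversed upwards and deformed in a bounded region, so as to have the
  increasing sequences of poles on its right and the decreasing ones on its left. The sides are
  expressed by closing a long piece of the curve with a (clockwise) semicircle in the right
  half plane.
\<close>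

definition wilson_contour ::
  "complex \<Rightarrow> complex \<Rightarrow> complex \<Rightarrow> complex \<Rightarrow> (real \<Rightarrow> complex) \<Rightarrow> bool" where
  "wilson_contour a b c d \<gamma> \<longleftrightarrow>
     inj \<gamma> \<and>
     (\<forall>r. \<gamma> piecewise_C1_differentiable_on {- r..r}) \<and>
     (\<exists>R>0. \<forall>s. \<bar>s\<bar> \<ge> R \<longrightarrow> \<gamma> s = \<i> * of_real s) \<and>
     (\<forall>x\<in>{a, b, c, d}. \<forall>k::nat.
        x + of_nat k \<notin> range \<gamma> \<and> - x - of_nat k \<notin> range \<gamma> \<and>
        (\<forall>\<^sub>F r in at_top.
           winding_number ((\<lambda>x. \<gamma> (2 * r * x - r)) +++ part_circlepath 0 r (pi/2) (- pi/2))
             (x + of_nat k) = - 1 \<and>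
           winding_number ((\<lambda>x. \<gamma> (2 * r * x - r)) +++ part_circlepath 0 r (pi/2) (- pi/2))
             (- x - of_nat k) = 0))"

definition wilson_orthogonal ::
  "nat \<Rightarrow> (nat \<Rightarrow> nat) \<Rightarrow> complex \<Rightarrow> (nat \<Rightarrow> complex) \<Rightarrow> complex \<Rightarrow> complex \<Rightarrow> complex poly \<Rightarrow> bool" where
  "wilson_orthogonal m n a b c d p \<longleftrightarrow>
     degree p = (\<Sum>j=1..m. n j) \<and>
     (\<forall>j\<in>{1..m}. \<forall>k<n j. \<forall>\<gamma>. wilson_contour a (b j) c d \<gamma> \<longrightarrow>
        ((\<lambda>s. poly p ((\<gamma> s)\<^sup>2) * \<gamma> s ^ (2 * k) * wilson_weight a (b j) c d (\<gamma> s) *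
               vector_derivative \<gamma> (at s)) has_integral 0) UNIV)"

text \<open>
  A polynomial that satisfies the orthogonality relations and is normalized as prescribed is
  \<^const>\<open>multiple_wilson\<close>; the normalization alone suffices for this.
\<close>

lemma wilson_normalized_unique:
  assumes "1 \<le> m" "wilson_normalized m n a b c d p" "wilson_normalized m n a b c d q"
  shows "p = q"
proof -
  have "poly p x = poly q x" for x
  proof -
    have "poly p ((csqrt x)\<^sup>2) = poly q ((csqrt x)\<^sup>2)"
      using assms unfolding wilson_normalized_def
      by (metis atLeastAtMost_iff order_refl)
    thus ?thesis by simp
  qed
  thus ?thesis
    using poly_eq_poly_eq_iff by blast
qed

lemma orthogonal_normalized_imp_multiple_wilson:
  assumes "1 \<le> m" "wilson_orthogonal m n a b c d p" "wilson_normalized m n a b c d p"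
  shows "p = multiple_wilson m n a b c d"
  unfolding multiple_wilson_def
  by (rule the_equality [symmetric]) (use assms wilson_normalized_unique in blast)+


text \<open>
  Rising factorial without its zero factors. In the first representation it is used for the
  Pochhammer symbols with base \<open>\<sigma>\<^sub>i + s\<^sub>i\<close>, which occur as \<open>(\<sigma>\<^sub>i + s\<^sub>i)\<^sub>K\<close> with \<open>K = K\<^sub>i\<^sub>-\<^sub>1\<close> in the
  numerator (\<open>K\<^sub>0 = |k|\<close>) and \<open>K = K\<^sub>i\<close> in the denominator (\<open>i < m\<close>). As no \<open>\<sigma>\<^sub>i + 1\<close> is a nonpositive
  integer, a factor can only vanish if \<open>\<sigma>\<^sub>i = 0\<close> and \<open>n\<^sub>1 = \<dots> = n\<^sub>i = 0\<close>; then \<open>k\<^sub>i = 0\<close> and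
  \<open>K\<^sub>i\<^sub>-\<^sub>1 = K\<^sub>i\<close>, so that this factor is the same in numerator and denominator (and is absent if
  \<open>i = m\<close>, where \<open>K\<^sub>m = 0\<close>). Hence dropping it is precisely the cancellation of the common factor
  zero, and otherwise this is the ordinary \<^const>\<open>pochhammer\<close>.
\<close>

definition pochhammer_nz :: "complex \<Rightarrow> nat \<Rightarrow> complex" where
  "pochhammer_nz x k = (\<Prod>i\<in>{i. i < k \<and> x + of_nat i \<noteq> 0}. x + of_nat i)"

end

theory Submission
  imports Defs
begin

text \<open>
  The key observation is that the expansion that normalizes the multiple Wilson polynomial is the
  image of the Jacobi-Pineiro polynomial \<open>P\<close> under a linear map that does not depend on \<open>j\<close>. The
  \<open>\<^sub>4F\<^sub>3\<close> series of the Wilson polynomial \<open>p\<^sub>l(t\<^sup>2; a, b\<^sub>j, c, d)\<close> is the \<open>\<^sub>2F\<^sub>1\<close> series of the Jacobi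
  polynomial \<open>P\<^sub>l\<close> with parameters \<open>\<alpha>\<^sub>j = a + b\<^sub>j - 1\<close> and \<open>\<beta> = c + d - 1\<close>, in which \<open>u\<^sup>k\<close> is replaced by
  \<open>(a-t)\<^sub>k (a+t)\<^sub>k / ((a+c)\<^sub>k (a+d)\<^sub>k)\<close>, and the weights in the expansion turn the remaining factors,
  which depend on \<open>l\<close>, into the constant \<open>(a+c)\<^sub>N (a+d)\<^sub>N\<close> with \<open>N = |n|\<close>. Applied to the expansion of
  \<open>P\<close> in Jacobi polynomials, this map (\<open>wilson_transform\<close>) gives, up to constants, the multiple
  Wilson polynomial (\<open>multiple_wilson_eq_transform\<close>). Consequently every expansion of \<open>P\<close> in
  powers of \<open>u\<close> yields a hypergeometric representation, and both representations come from such
  expansions.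

  The operator \<open>u\<^sup>-\<^sup>\<alpha> D\<^sup>n u\<^sup>n\<^sup>+\<^sup>\<alpha>\<close> of the Rodrigues formula multiplies \<open>u\<^sup>k\<close> by \<open>(\<alpha>+1+k)\<^sub>n\<close>. Hence it can be
  studied on formal power series, where these operators obviously commute. Multiplying the
  transformed binomial series by \<open>(1-u)\<^sup>-\<^sup>\<beta>\<close> gives the second representation directly. The
  first one results from applying the operators one at a time, starting with index \<open>m\<close>, and using
  Euler's transformation of \<open>\<^sub>2F\<^sub>1\<close> each time: the operator maps \<open>u\<^sup>q (1-u)\<^sup>\<gamma>\<close> to \<open>(1-u)\<^sup>\<gamma>\<^sup>-\<^sup>n\<close> times an
  explicit polynomial of degree at most \<open>q + n\<close> (\<open>rodrigues_fps_X_power_mult\<close>). This also shows that \<open>P\<close> is a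
  polynomial of degree at most \<open>N\<close>.

  It remains to see that the coefficients \<open>c\<^sub>l\<close> are well defined, i.e. that \<open>P\<close> has a unique
  expansion in the Jacobi polynomials of index \<open>n\<^sub>j \<le> l \<le> N\<close>. Uniqueness holds because they have
  degree exactly \<open>l\<close>. For existence, the operator with index \<open>j\<close> is applied last. It then acts on
  \<open>(1-u)\<^sup>\<beta>\<^sup>+\<^sup>n Q(u)\<close>, where \<open>n = n\<^sub>j\<close> and \<open>Q\<close> is a polynomial, which can be expanded in Jacobi polynomials
  with both parameters raised by \<open>n\<close>; by their own Rodrigues formula, these are mapped to multiples of
  the Jacobi polynomials of index at least \<open>n\<close> with the original parameters.
\<close>

(* The \<open>$\<close> notation is kept for coefficients of power series. The simproc would turn equations
   between power series into equations between polynomials. *)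
unbundle no vec_syntax
declare [[simproc del: poly_fps_eq]]

section \<open>Rodrigues operators on formal power series\<close>

definition one_minus_X_powr :: "complex \<Rightarrow> complex fps" where
  "one_minus_X_powr \<gamma> = fps_compose (fps_binomial \<gamma>) (- fps_X)"

lemma one_minus_X_powr_nth [simp]:
  "one_minus_X_powr \<gamma> $ k = pochhammer (- \<gamma>) k / fact k"
  by (simp add: one_minus_X_powr_def fps_compose_uminus' gbinomial_pochhammer
      mult.assoc [symmetric] flip: power_add)

lemma one_minus_X_powr_add:
  "one_minus_X_powr (\<gamma> + \<delta>) = one_minus_X_powr \<gamma> * one_minus_X_powr \<delta>"
  by (simp add: one_minus_X_powr_def fps_binomial_add_mult fps_compose_mult_distrib)

lemma one_minus_X_powr_0 [simp]: "one_minus_X_powr 0 = 1"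
  by (simp add: one_minus_X_powr_def)

lemma one_minus_X_powr_cancel: "one_minus_X_powr (- \<gamma>) * (one_minus_X_powr \<gamma> * F) = F"
  by (simp add: mult.assoc [symmetric] flip: one_minus_X_powr_add)

lemma one_minus_X_powr_1: "one_minus_X_powr 1 = 1 - fps_X"
  by (simp add: one_minus_X_powr_def fps_binomial_1 fps_compose_add_distrib)

lemma one_minus_X_powr_step: "one_minus_X_powr \<gamma> = one_minus_X_powr (\<gamma> - 1) * (1 - fps_X)"
  using one_minus_X_powr_add [of "\<gamma> - 1" 1] by (simp add: one_minus_X_powr_1)

lemma one_minus_X_powr_deriv:
  "fps_deriv (one_minus_X_powr \<gamma>) = - (fps_const \<gamma> * one_minus_X_powr (\<gamma> - 1))"
  by (rule fps_ext) (simp add: pochhammer_rec field_simps del: of_nat_Suc)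

text \<open>
  The formal counterpart of \<open>u\<^sup>-\<^sup>\<alpha> D\<^sup>n u\<^sup>n\<^sup>+\<^sup>\<alpha>\<close>, which maps \<open>u\<^sup>k\<close> to \<open>(\<alpha>+1+k)\<^sub>n u\<^sup>k\<close>.
\<close>

definition rodrigues_fps :: "nat \<Rightarrow> complex \<Rightarrow> complex fps \<Rightarrow> complex fps" where
  "rodrigues_fps n \<alpha> F = Abs_fps (\<lambda>k. pochhammer (\<alpha> + 1 + of_nat k) n * F $ k)"

lemma rodrigues_fps_nth [simp]:
  "rodrigues_fps n \<alpha> F $ k = pochhammer (\<alpha> + 1 + of_nat k) n * F $ k"
  by (simp add: rodrigues_fps_def)

lemma rodrigues_fps_0 [simp]: "rodrigues_fps 0 \<alpha> F = F"
  by (rule fps_ext) simp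

lemma rodrigues_fps_Suc:
  "rodrigues_fps (Suc n) \<alpha> F = fps_XDp (\<alpha> + of_nat n + 1) (rodrigues_fps n \<alpha> F)"
  by (rule fps_ext) (simp add: pochhammer_Suc algebra_simps)

lemma rodrigues_fps_Suc':
  "rodrigues_fps (Suc n) \<alpha> F = rodrigues_fps n \<alpha> (fps_XDp (\<alpha> + of_nat n + 1) F)"
  by (rule fps_ext) (simp add: pochhammer_Suc algebra_simps)

lemma rodrigues_fps_const_mult:
  "rodrigues_fps n \<alpha> (fps_const c * F) = fps_const c * rodrigues_fps n \<alpha> F"
  by (rule fps_ext) (simp add: algebra_simps)

lemma rodrigues_fps_sum:
  "rodrigues_fps n \<alpha> (\<Sum>i\<in>A. F i) = (\<Sum>i\<in>A. rodrigues_fps n \<alpha> (F i))"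
  by (rule fps_ext) (simp add: fps_sum_nth sum_distrib_left)

text \<open>
  The coefficients of the polynomial \<open>(x)\<^sub>n \<^sub>2F\<^sub>1(-n, x+\<gamma>; x; u)\<close>, written without a denominator so
  that they make sense for every \<open>x\<close>.
\<close>

definition euler_coeff :: "nat \<Rightarrow> complex \<Rightarrow> complex \<Rightarrow> nat \<Rightarrow> complex" where
  "euler_coeff n x \<gamma> k =
     (-1) ^ k * of_nat (n choose k) * pochhammer (x + of_nat k) (n - k) * pochhammer (x + \<gamma>) k"

lemma euler_coeff_Suc_0: "euler_coeff (Suc n) x \<gamma> 0 = (x + of_nat n) * euler_coeff n x \<gamma> 0"
  by (simp add: euler_coeff_def pochhammer_Suc)

lemma euler_coeff_Suc_Suc:
  "euler_coeff (Suc n) x \<gamma> (Suc k) =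
     (x + of_nat n + of_nat (Suc k)) * euler_coeff n x \<gamma> (Suc k) -
     (x + \<gamma> + of_nat k) * euler_coeff n x \<gamma> k"
proof (cases "k < n")
  case True
  define P where "P = pochhammer (x + of_nat (Suc k)) (n - Suc k)"
  have ab: "of_nat (Suc k) * of_nat (n choose Suc k) = (of_nat n - of_nat k :: complex) * of_nat (n choose k)"
  proof -
    have "Suc k * (n choose Suc k) = (n - k) * (n choose k)"
      by (metis binomial_absorb_comp binomial_absorption)
    hence "of_nat (Suc k * (n choose Suc k)) = (of_nat ((n - k) * (n choose k)) :: complex)"
      by simp
    thus ?thesis using True by (simp only: of_nat_mult of_nat_diff less_imp_le)
  qed
  have nk: "n - k = Suc (n - Suc k)" and nk': "Suc n - Suc k = Suc (n - Suc k)"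
    using True by simp_all
  have 1: "pochhammer (x + of_nat k) (n - k) = (x + of_nat k) * P"
    unfolding nk P_def pochhammer_rec [of "x + of_nat k"] by (simp add: add_ac)
  have "x + of_nat (Suc k) + of_nat (n - Suc k) = x + (of_nat n :: complex)"
    using True by (simp add: Suc_leI of_nat_diff)
  hence 2: "pochhammer (x + of_nat (Suc k)) (Suc n - Suc k) = P * (x + of_nat n)"
    unfolding nk' P_def pochhammer_Suc by (rule arg_cong)
  have 3: "(x + of_nat n) * (of_nat (n choose k) + of_nat (n choose Suc k)) =
      (x + of_nat n + of_nat (Suc k)) * of_nat (n choose Suc k) + (x + of_nat k) * (of_nat (n choose k))"
    using ab by (simp add: algebra_simps)
  have "euler_coeff (Suc n) x \<gamma> (Suc k) = (-1) ^ Suc k * P * pochhammer (x + \<gamma>) (Suc k) *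
     ((x + of_nat n) * (of_nat (n choose k) + of_nat (n choose Suc k)))"
    unfolding euler_coeff_def 2 by (simp add: mult_ac)
  also have "\<dots> = (x + of_nat n + of_nat (Suc k)) * euler_coeff n x \<gamma> (Suc k) -
     (x + \<gamma> + of_nat k) * euler_coeff n x \<gamma> k"
    unfolding 3 euler_coeff_def 1 P_def[symmetric] pochhammer_Suc by (simp add: algebra_simps)
  finally show ?thesis .
next
  case False
  thus ?thesis by (cases "k = n") (auto simp: euler_coeff_def pochhammer_Suc binomial_eq_0)
qed

text \<open>
  This is Euler's transformation. With \<open>x = \<alpha>+1+q\<close>, the left hand side is
  \<open>(x)\<^sub>n u\<^sup>q \<^sub>2F\<^sub>1(-\<gamma>, x+n; x; u)\<close>, and the transformation extracts the factor \<open>(1-u)\<^sup>\<gamma>\<^sup>-\<^sup>n\<close> and leaves a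
  terminating series. By induction on \<open>n\<close>, it reduces to the Pascal-type recurrence for
  \<^const>\<open>euler_coeff\<close>, since each step applies one first-order operator \<open>u D + (\<alpha>+n+1)\<close>.
\<close>

lemma rodrigues_fps_X_power_mult:
  "rodrigues_fps n \<alpha> (fps_X ^ q * one_minus_X_powr \<gamma>) =
     one_minus_X_powr (\<gamma> - of_nat n) *
     (\<Sum>k\<le>n. fps_const (euler_coeff n (\<alpha> + 1 + of_nat q) \<gamma> k) * fps_X ^ (q + k))"
proof (induction n)
  case 0
  show ?case by (simp add: euler_coeff_def mult.commute)
next
  case (Suc n)
  define x where "x = \<alpha> + 1 + of_nat q"
  define \<delta> where "\<delta> = \<gamma> - of_nat n"
  define A where "A = euler_coeff n x \<gamma>"
  have monom: "fps_XDp c (one_minus_X_powr \<delta> * fps_X ^ p) = one_minus_X_powr (\<delta> - 1) *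
      (fps_const (c + of_nat p) * fps_X ^ p - fps_const (c + of_nat p + \<delta>) * fps_X ^ Suc p)" for c p
  proof -
    have XD: "fps_X * fps_deriv (fps_X ^ p) = fps_const (of_nat p) * (fps_X ^ p :: complex fps)"
      by (rule fps_ext) simp
    have "fps_XDp c (one_minus_X_powr \<delta> * fps_X ^ p) =
        fps_X * fps_deriv (one_minus_X_powr \<delta>) * fps_X ^ p +
        one_minus_X_powr \<delta> * (fps_X * fps_deriv (fps_X ^ p)) +
        fps_const c * one_minus_X_powr \<delta> * fps_X ^ p"
      by (simp add: fps_XDp_def fps_XD_def algebra_simps)
    also have "\<dots> = one_minus_X_powr (\<delta> - 1) *
      (fps_const (c + of_nat p) * fps_X ^ p - fps_const (c + of_nat p + \<delta>) * fps_X ^ Suc p)"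
      unfolding XD one_minus_X_powr_deriv unfolding one_minus_X_powr_step [of \<delta>]
      by (simp add: algebra_simps flip: fps_const_add)
    finally show ?thesis .
  qed
  have lin: "fps_XDp c (\<Sum>k\<in>S. fps_const (A k) * F k) = (\<Sum>k\<in>S. fps_const (A k) * fps_XDp c (F k))"
    for c S F by (rule fps_ext) (simp add: fps_sum_nth sum_distrib_left mult_ac)
  have "rodrigues_fps (Suc n) \<alpha> (fps_X ^ q * one_minus_X_powr \<gamma>) =
      fps_XDp (\<alpha> + of_nat n + 1) (\<Sum>k\<le>n. fps_const (A k) * (one_minus_X_powr \<delta> * fps_X ^ (q + k)))"
    unfolding rodrigues_fps_Suc Suc A_def x_def \<delta>_def by (simp add: sum_distrib_left mult_ac)
  also have "\<dots> = one_minus_X_powr (\<delta> - 1) *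
      ((\<Sum>k\<le>n. fps_const (A k * (x + of_nat n + of_nat k)) * fps_X ^ (q + k)) -
       (\<Sum>k\<le>n. fps_const (A k * (x + \<gamma> + of_nat k)) * fps_X ^ (q + Suc k)))"
    unfolding lin monom
    by (simp add: sum_subtractf sum_distrib_left right_diff_distrib x_def \<delta>_def mult_ac add_ac
         flip: fps_const_mult)
  also have "(\<Sum>k\<le>n. fps_const (A k * (x + of_nat n + of_nat k)) * fps_X ^ (q + k)) =
      (\<Sum>k\<le>Suc n. fps_const (A k * (x + of_nat n + of_nat k)) * fps_X ^ (q + k))"
    by (simp add: A_def euler_coeff_def)
  also have "\<dots> = fps_const (A 0 * (x + of_nat n)) * fps_X ^ q +
     (\<Sum>k\<le>n. fps_const (A (Suc k) * (x + of_nat n + of_nat (Suc k))) * fps_X ^ (q + Suc k))"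
    by (subst sum.atMost_Suc_shift) simp
  also have "\<dots> - (\<Sum>k\<le>n. fps_const (A k * (x + \<gamma> + of_nat k)) * fps_X ^ (q + Suc k)) =
     fps_const (euler_coeff (Suc n) x \<gamma> 0) * fps_X ^ (q + 0) +
     (\<Sum>k\<le>n. fps_const (euler_coeff (Suc n) x \<gamma> (Suc k)) * fps_X ^ (q + Suc k))"
    unfolding euler_coeff_Suc_0 euler_coeff_Suc_Suc A_def [symmetric]
    by (simp add: sum_subtractf ring_distribs mult_ac flip: fps_const_sub del: of_nat_Suc fps_const_mult)
  also have "\<dots> = (\<Sum>k\<le>Suc n. fps_const (euler_coeff (Suc n) x \<gamma> k) * fps_X ^ (q + k))"
    by (subst sum.atMost_Suc_shift) simp
  finally show ?case by (simp add: x_def \<delta>_def diff_diff_eq add.commute)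
qed

section \<open>Jacobi polynomials and their span\<close>

definition jacobi_poly :: "nat \<Rightarrow> complex \<Rightarrow> complex \<Rightarrow> complex poly" where
  "jacobi_poly l \<alpha> \<beta> = (\<Sum>k\<le>l. monom (euler_coeff l (\<alpha> + 1) (\<beta> + of_nat l) k / fact l) k)"

lemma coeff_jacobi_poly:
  "coeff (jacobi_poly l \<alpha> \<beta>) k = euler_coeff l (\<alpha> + 1) (\<beta> + of_nat l) k / fact l"
proof -
  have "euler_coeff l (\<alpha> + 1) (\<beta> + of_nat l) k = 0" if "k > l"
    using that by (simp add: euler_coeff_def)
  thus ?thesis by (auto simp: jacobi_poly_def coeff_sum not_le)
qed

lemma degree_jacobi_poly: "degree (jacobi_poly l \<alpha> \<beta>) \<le> l"
  by (rule degree_le) (simp add: coeff_jacobi_poly euler_coeff_def)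

lemma coeff_degree_jacobi_poly:
  assumes "\<alpha> + \<beta> + 2 \<notin> \<int>\<^sub>\<le>\<^sub>0"
  shows "coeff (jacobi_poly l \<alpha> \<beta>) l \<noteq> 0"
proof -
  have "pochhammer (\<alpha> + 1 + (\<beta> + of_nat l)) l \<noteq> 0"
  proof
    assume "pochhammer (\<alpha> + 1 + (\<beta> + of_nat l)) l = 0"
    then obtain k where k: "k < l" "\<alpha> + 1 + (\<beta> + of_nat l) = - of_nat k"
      by (auto simp: pochhammer_eq_0_iff)
    hence "\<alpha> + \<beta> + 2 = - of_nat (k + (l - 1))"
      by (simp add: algebra_simps of_nat_diff eq_neg_iff_add_eq_0)
    thus False using assms by (metis minus_of_nat_in_nonpos_Ints)
  qed
  thus ?thesis by (simp add: coeff_jacobi_poly euler_coeff_def)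
qed

text \<open>
  The classical Rodrigues formula, which is the case \<open>q = 0\<close>, \<open>\<gamma> = \<beta> + l\<close> of Euler's transformation.
\<close>

lemma fps_of_jacobi_poly:
  "fps_of_poly (jacobi_poly l \<alpha> \<beta>) = fps_const (1 / fact l) *
     (one_minus_X_powr (- \<beta>) * rodrigues_fps l \<alpha> (one_minus_X_powr (\<beta> + of_nat l)))"
proof -
  have "rodrigues_fps l \<alpha> (one_minus_X_powr (\<beta> + of_nat l)) = one_minus_X_powr \<beta> *
      (\<Sum>k\<le>l. fps_const (euler_coeff l (\<alpha> + 1) (\<beta> + of_nat l) k) * fps_X ^ k)"
    using rodrigues_fps_X_power_mult [of l \<alpha> 0 "\<beta> + of_nat l"] by simp
  moreover note one_minus_X_powr_cancel [of \<beta>]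
  moreover have "fps_of_poly (jacobi_poly l \<alpha> \<beta>) = fps_const (1 / fact l) *
      (\<Sum>k\<le>l. fps_const (euler_coeff l (\<alpha> + 1) (\<beta> + of_nat l) k) * fps_X ^ k)"
    by (simp add: jacobi_poly_def fps_of_poly_sum fps_of_poly_monom sum_distrib_left
        mult.assoc [symmetric])
  ultimately show ?thesis by simp
qed

lemma triangular_poly_span:
  fixes B :: "nat \<Rightarrow> 'a::field poly"
  assumes "\<And>k. degree (B k) \<le> k" "\<And>k. coeff (B k) k \<noteq> 0" "degree Q \<le> M"
  shows "\<exists>c. Q = (\<Sum>k\<le>M. smult (c k) (B k))"
  using assms(3)
proof (induction M arbitrary: Q)
  case 0
  obtain q where q: "Q = [:q:]" using 0 by (auto elim: degree_eq_zeroE)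
  obtain x where x: "B 0 = [:x:]" using assms(1) [of 0] by (auto elim: degree_eq_zeroE)
  have "x \<noteq> 0" using assms(2) [of 0] x by simp
  thus ?case by (intro exI [of _ "\<lambda>_. q / x"]) (simp add: q x)
next
  case (Suc M)
  define x where "x = coeff Q (Suc M) / coeff (B (Suc M)) (Suc M)"
  have "degree (Q - smult x (B (Suc M))) \<le> M"
  proof (rule degree_le, intro allI impI)
    fix i assume "i > M"
    show "coeff (Q - smult x (B (Suc M))) i = 0"
    proof (cases "i = Suc M")
      case True
      thus ?thesis using assms(2) by (simp add: x_def)
    next
      case False
      hence "i > degree Q" "i > degree (B (Suc M))"
        using \<open>i > M\<close> Suc.prems assms(1) [of "Suc M"] by linarith+
      thus ?thesis by (simp add: coeff_eq_0)
    qed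
  qed
  then obtain c where "Q - smult x (B (Suc M)) = (\<Sum>k\<le>M. smult (c k) (B k))"
    using Suc.IH by blast
  hence "Q = (\<Sum>k\<le>M. smult (c k) (B k)) + smult x (B (Suc M))" by (simp add: algebra_simps)
  thus ?case by (intro exI [of _ "c(Suc M := x)"]) simp
qed

lemma triangular_poly_independent:
  fixes B :: "nat \<Rightarrow> 'a::field poly"
  assumes "\<And>k. degree (B k) \<le> k" "\<And>k. coeff (B k) k \<noteq> 0"
    and "(\<Sum>k\<le>M. smult (c k) (B k)) = 0" "k \<le> M"
  shows "c k = 0"
  using assms(3,4)
proof (induction M)
  case 0
  thus ?case using assms(2) [of 0] by auto
next
  case (Suc M)
  have "coeff (\<Sum>k\<le>M. smult (c k) (B k)) (Suc M) = 0"
    unfolding coeff_sum using assms(1)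
    by (intro sum.neutral) (auto intro!: coeff_eq_0 intro: le_imp_less_Suc order.trans)
  hence "c (Suc M) * coeff (B (Suc M)) (Suc M) = coeff (\<Sum>k\<le>Suc M. smult (c k) (B k)) (Suc M)"
    by simp
  also have "\<dots> = 0" by (simp only: Suc.prems(1) coeff_0)
  finally have 0: "c (Suc M) = 0" using assms(2) by simp
  show ?case using Suc 0 by (cases "k = Suc M") auto
qed

lemma rodrigues_fps_rodrigues_fps:
  "rodrigues_fps n \<alpha> (rodrigues_fps k (\<alpha> + of_nat n) F) = rodrigues_fps (n + k) \<alpha> F"
  proof (rule fps_ext)
  fix i
  show "rodrigues_fps n \<alpha> (rodrigues_fps k (\<alpha> + of_nat n) F) $ i = rodrigues_fps (n + k) \<alpha> F $ i"
    using pochhammer_product' [of "\<alpha> + 1 + of_nat i" n k] by (simp add: add_ac)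
qed

text \<open>
  The algebraic substitute for orthogonality: Jacobi polynomials of index below \<open>n\<close> do not occur.
  The polynomial \<open>Q\<close> is expanded in the Jacobi polynomials with parameters \<open>\<alpha>+n\<close> and \<open>\<beta>+n\<close>. In the
  Rodrigues formula of these, the outer factor \<open>(1-u)\<^sup>-\<^sup>\<beta>\<^sup>-\<^sup>n\<close> cancels against \<open>(1-u)\<^sup>\<beta>\<^sup>+\<^sup>n\<close>, and the
  operators of orders \<open>n\<close> and \<open>k\<close> combine into the one of order \<open>n + k\<close>, which is the Rodrigues
  formula for index \<open>n + k\<close> and the original parameters.
\<close>

lemma rodrigues_fps_jacobi_span:
  assumes "\<alpha> + \<beta> + 2 \<notin> \<int>\<^sub>\<le>\<^sub>0" "degree Q \<le> M"
  obtains c where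
    "one_minus_X_powr (- \<beta>) * rodrigues_fps n \<alpha> (one_minus_X_powr (\<beta> + of_nat n) * fps_of_poly Q) =
       fps_of_poly (\<Sum>k\<le>M. smult (c k) (jacobi_poly (n + k) \<alpha> \<beta>))"
proof -
  let ?\<alpha> = "\<alpha> + of_nat n" and ?\<beta> = "\<beta> + of_nat n"
  have "?\<alpha> + ?\<beta> + 2 \<notin> \<int>\<^sub>\<le>\<^sub>0"
  proof
    assume "?\<alpha> + ?\<beta> + 2 \<in> \<int>\<^sub>\<le>\<^sub>0"
    then obtain k where "?\<alpha> + ?\<beta> + 2 = - of_nat k" by (auto elim: nonpos_Ints_cases')
    hence "\<alpha> + \<beta> + 2 = - of_nat (k + 2 * n)" by (simp add: algebra_simps eq_neg_iff_add_eq_0)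
    thus False using assms(1) by (metis minus_of_nat_in_nonpos_Ints)
  qed
  then obtain c where c: "Q = (\<Sum>k\<le>M. smult (c k) (jacobi_poly k ?\<alpha> ?\<beta>))"
    using triangular_poly_span [of "\<lambda>k. jacobi_poly k ?\<alpha> ?\<beta>" Q M]
    by (metis degree_jacobi_poly coeff_degree_jacobi_poly assms(2))
  have step: "one_minus_X_powr (- \<beta>) * rodrigues_fps n \<alpha> (one_minus_X_powr ?\<beta> *
      fps_of_poly (jacobi_poly k ?\<alpha> ?\<beta>)) =
      fps_const (fact (n + k) / fact k) * fps_of_poly (jacobi_poly (n + k) \<alpha> \<beta>)" for k
  proof -
    have "one_minus_X_powr ?\<beta> * fps_of_poly (jacobi_poly k ?\<alpha> ?\<beta>) =
        fps_const (1 / fact k) * (one_minus_X_powr ?\<beta> * one_minus_X_powr (- ?\<beta>) *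
          rodrigues_fps k ?\<alpha> (one_minus_X_powr (?\<beta> + of_nat k)))"
      unfolding fps_of_jacobi_poly by (simp only: mult_ac)
    also have "\<dots> = fps_const (1 / fact k) * rodrigues_fps k ?\<alpha> (one_minus_X_powr (?\<beta> + of_nat k))"
      unfolding one_minus_X_powr_add [symmetric] by simp
    finally have *: "one_minus_X_powr ?\<beta> * fps_of_poly (jacobi_poly k ?\<alpha> ?\<beta>) =
        fps_const (1 / fact k) * rodrigues_fps k ?\<alpha> (one_minus_X_powr (?\<beta> + of_nat k))" .
    show ?thesis
      unfolding * unfolding fps_of_jacobi_poly
      by (simp add: rodrigues_fps_const_mult rodrigues_fps_rodrigues_fps mult.left_commute add_ac
           mult.assoc [symmetric])
  qed
  have "one_minus_X_powr (- \<beta>) * rodrigues_fps n \<alpha> (one_minus_X_powr ?\<beta> * fps_of_poly Q) =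
      (\<Sum>k\<le>M. fps_const (c k) * (one_minus_X_powr (- \<beta>) * rodrigues_fps n \<alpha> (one_minus_X_powr ?\<beta> *
      fps_of_poly (jacobi_poly k ?\<alpha> ?\<beta>))))"
    unfolding c fps_of_poly_sum fps_of_poly_smult sum_distrib_left
    by (simp add: rodrigues_fps_sum rodrigues_fps_const_mult mult.left_commute sum_distrib_left)
  also have "\<dots> = fps_of_poly (\<Sum>k\<le>M. smult (c k * (fact (n + k) / fact k)) (jacobi_poly (n + k) \<alpha> \<beta>))"
    unfolding step fps_of_poly_sum fps_of_poly_smult by (simp add: mult.assoc [symmetric])
  finally show ?thesis by (rule that)
qed

lemma rodrigues_fps_poly:
  assumes "degree Q \<le> M"
  obtains Q' where "degree Q' \<le> M + n"
    "rodrigues_fps n \<alpha> (one_minus_X_powr \<gamma> * fps_of_poly Q) =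
       one_minus_X_powr (\<gamma> - of_nat n) * fps_of_poly Q'"
proof -
  define R where "R q = (\<Sum>k\<le>n. monom (euler_coeff n (\<alpha> + 1 + of_nat q) \<gamma> k) (q + k))" for q
  define Q' where "Q' = (\<Sum>q\<le>M. smult (coeff Q q) (R q))"
  have Q: "fps_of_poly Q = (\<Sum>q\<le>M. fps_const (coeff Q q) * fps_X ^ q)"
    using poly_as_sum_of_monoms' [OF assms]
    by (metis (no_types, lifting) fps_of_poly_monom fps_of_poly_sum sum.cong)
  have "degree Q' \<le> M + n"
    unfolding Q'_def R_def
    by (intro degree_sum_le order.trans [OF degree_smult_le] order.trans [OF degree_monom_le]) auto
  moreover have "rodrigues_fps n \<alpha> (one_minus_X_powr \<gamma> * fps_of_poly Q) =
      (\<Sum>q\<le>M. fps_const (coeff Q q) * rodrigues_fps n \<alpha> (fps_X ^ q * one_minus_X_powr \<gamma>))"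
    unfolding Q sum_distrib_left
    by (simp add: rodrigues_fps_sum mult_ac flip: rodrigues_fps_const_mult)
  moreover have "\<dots> = one_minus_X_powr (\<gamma> - of_nat n) * fps_of_poly Q'"
    unfolding rodrigues_fps_X_power_mult Q'_def R_def
    by (simp add: fps_of_poly_sum fps_of_poly_smult fps_of_poly_monom sum_distrib_left
         mult.left_commute)
  ultimately show ?thesis using that by auto
qed

section \<open>The Jacobi-Pineiro polynomial as a formal power series\<close>

text \<open>
  The composition of the operators with index in \<open>S\<close>. As an operator that acts on the coefficients,
  it visibly does not depend on the order of the factors, so any index can be taken to be the last.
\<close>

definition multi_rodrigues_fps ::
  "'i set \<Rightarrow> ('i \<Rightarrow> nat) \<Rightarrow> ('i \<Rightarrow> complex) \<Rightarrow> complex fps \<Rightarrow> complex fps" where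
  "multi_rodrigues_fps S n \<alpha> F =
     Abs_fps (\<lambda>k. (\<Prod>j\<in>S. pochhammer (\<alpha> j + 1 + of_nat k) (n j)) * F $ k)"

lemma multi_rodrigues_fps_nth [simp]:
  "multi_rodrigues_fps S n \<alpha> F $ k = (\<Prod>j\<in>S. pochhammer (\<alpha> j + 1 + of_nat k) (n j)) * F $ k"
  by (simp add: multi_rodrigues_fps_def)

lemma multi_rodrigues_fps_empty [simp]: "multi_rodrigues_fps {} n \<alpha> F = F"
  by (rule fps_ext) simp

lemma multi_rodrigues_fps_insert:
  "finite S \<Longrightarrow> i \<notin> S \<Longrightarrow>
     multi_rodrigues_fps (insert i S) n \<alpha> F = rodrigues_fps (n i) (\<alpha> i) (multi_rodrigues_fps S n \<alpha> F)"
  by (rule fps_ext) simp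

lemma multi_rodrigues_fps_poly:
  assumes "finite S"
  obtains Q where "degree Q \<le> (\<Sum>j\<in>S. n j)"
    "multi_rodrigues_fps S n \<alpha> (one_minus_X_powr \<gamma>) =
       one_minus_X_powr (\<gamma> - of_nat (\<Sum>j\<in>S. n j)) * fps_of_poly Q"
proof -
  from assms have "\<exists>Q. degree Q \<le> (\<Sum>j\<in>S. n j) \<and>
    multi_rodrigues_fps S n \<alpha> (one_minus_X_powr \<gamma>) =
       one_minus_X_powr (\<gamma> - of_nat (\<Sum>j\<in>S. n j)) * fps_of_poly Q"
  proof (induction S)
    case empty
    show ?case by (intro exI [of _ 1]) simp
  next
    case (insert i S)
    then obtain Q where Q: "degree Q \<le> (\<Sum>j\<in>S. n j)" "multi_rodrigues_fps S n \<alpha> (one_minus_X_powr \<gamma>) =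
       one_minus_X_powr (\<gamma> - of_nat (\<Sum>j\<in>S. n j)) * fps_of_poly Q" by blast
    obtain Q' where Q': "degree Q' \<le> (\<Sum>j\<in>S. n j) + n i"
      "rodrigues_fps (n i) (\<alpha> i) (one_minus_X_powr (\<gamma> - of_nat (\<Sum>j\<in>S. n j)) * fps_of_poly Q) =
       one_minus_X_powr (\<gamma> - of_nat (\<Sum>j\<in>S. n j) - of_nat (n i)) * fps_of_poly Q'"
      by (rule rodrigues_fps_poly [OF Q(1)])
    show ?case
      using Q' insert.hyps
      by (intro exI [of _ Q']) (simp add: multi_rodrigues_fps_insert Q(2) diff_diff_eq add_ac)
  qed
  thus ?thesis using that by blast
qed

definition jacobi_pineiro_fps ::
  "nat \<Rightarrow> (nat \<Rightarrow> nat) \<Rightarrow> (nat \<Rightarrow> complex) \<Rightarrow> complex \<Rightarrow> complex fps" where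
  "jacobi_pineiro_fps m n \<alpha> \<beta> = fps_const (1 / (\<Prod>j=1..m. fact (n j))) *
     (one_minus_X_powr (- \<beta>) *
      multi_rodrigues_fps {1..m} n \<alpha> (one_minus_X_powr (of_nat (\<Sum>j=1..m. n j) + \<beta>)))"

lemma jacobi_pineiro_fps_poly:
  obtains P where "degree P \<le> (\<Sum>j=1..m. n j)" "fps_of_poly P = jacobi_pineiro_fps m n \<alpha> \<beta>"
proof -
  obtain Q where Q: "degree Q \<le> (\<Sum>j=1..m. n j)"
    "multi_rodrigues_fps {1..m} n \<alpha> (one_minus_X_powr (of_nat (\<Sum>j=1..m. n j) + \<beta>)) =
       one_minus_X_powr (of_nat (\<Sum>j=1..m. n j) + \<beta> - of_nat (\<Sum>j=1..m. n j)) * fps_of_poly Q"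
    by (rule multi_rodrigues_fps_poly [OF finite_atLeastAtMost])
  have "fps_of_poly (smult (1 / (\<Prod>j=1..m. fact (n j))) Q) = jacobi_pineiro_fps m n \<alpha> \<beta>"
    unfolding jacobi_pineiro_fps_def Q(2) by (simp add: fps_of_poly_smult one_minus_X_powr_cancel)
  thus ?thesis using Q(1) that by (metis degree_smult_le order.trans)
qed

text \<open>
  The operators with index different from \<open>j\<close> produce \<open>(1-u)\<^sup>\<beta>\<^sup>+\<^sup>n\<close>, \<open>n = n\<^sub>j\<close>, times a polynomial of
  degree at most \<open>N - n\<^sub>j\<close>, and the operator with index \<open>j\<close> then acts as in
  \<open>rodrigues_fps_jacobi_span\<close>.
\<close>

lemma jacobi_pineiro_fps_jacobi_span:
  assumes j: "j \<in> {1..m}" and "\<alpha> j + \<beta> + 2 \<notin> \<int>\<^sub>\<le>\<^sub>0"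
  obtains c where "jacobi_pineiro_fps m n \<alpha> \<beta> =
     fps_of_poly (\<Sum>l = n j..\<Sum>i=1..m. n i. smult (c l) (jacobi_poly l (\<alpha> j) \<beta>))"
proof -
  define M where "M = (\<Sum>i\<in>{1..m} - {j}. n i)"
  have N: "(\<Sum>i=1..m. n i) = M + n j"
    using j by (simp add: M_def sum.remove add.commute)
  obtain Q where Q: "degree Q \<le> M"
    "multi_rodrigues_fps ({1..m} - {j}) n \<alpha> (one_minus_X_powr (of_nat (M + n j) + \<beta>)) =
       one_minus_X_powr (of_nat (M + n j) + \<beta> - of_nat M) * fps_of_poly Q"
    unfolding M_def by (rule multi_rodrigues_fps_poly [OF finite_Diff [OF finite_atLeastAtMost]])
  obtain c where c:
    "one_minus_X_powr (- \<beta>) * rodrigues_fps (n j) (\<alpha> j) (one_minus_X_powr (\<beta> + of_nat (n j)) * fps_of_poly Q) =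
       fps_of_poly (\<Sum>k\<le>M. smult (c k) (jacobi_poly (n j + k) (\<alpha> j) \<beta>))"
    using rodrigues_fps_jacobi_span [OF assms(2) Q(1)] .
  define f where "f = (1 / (\<Prod>j=1..m. fact (n j)) :: complex)"
  have "multi_rodrigues_fps {1..m} n \<alpha> (one_minus_X_powr (of_nat (M + n j) + \<beta>)) =
     rodrigues_fps (n j) (\<alpha> j) (one_minus_X_powr (\<beta> + of_nat (n j)) * fps_of_poly Q)"
    using multi_rodrigues_fps_insert [of "{1..m} - {j}" j] j Q(2)
    by (simp add: insert_absorb add_ac)
  hence "jacobi_pineiro_fps m n \<alpha> \<beta> =
     fps_of_poly (smult f (\<Sum>k\<le>M. smult (c k) (jacobi_poly (n j + k) (\<alpha> j) \<beta>)))"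
    unfolding jacobi_pineiro_fps_def N fps_of_poly_smult f_def by (simp add: c)
  also have "smult f (\<Sum>k\<le>M. smult (c k) (jacobi_poly (n j + k) (\<alpha> j) \<beta>)) =
     (\<Sum>k\<le>M. smult (f * c k) (jacobi_poly (n j + k) (\<alpha> j) \<beta>))"
    by (rule poly_eqI) (simp add: coeff_sum sum_distrib_left mult.assoc)
  also have "\<dots> = (\<Sum>l = n j..M + n j. smult (f * c (l - n j)) (jacobi_poly l (\<alpha> j) \<beta>))"
    by (rule sum.reindex_bij_witness [of _ "\<lambda>l. l - n j" "\<lambda>k. n j + k"]) auto
  finally show ?thesis using that [of "\<lambda>l. f * c (l - n j)"] unfolding N by blast
qed

section \<open>Evaluation of the Rodrigues formula\<close>

lemma fps_conv_radius_one_minus_X_powr: "fps_conv_radius (one_minus_X_powr \<gamma>) \<ge> 1"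
proof -
  have "fps_conv_radius (one_minus_X_powr \<gamma>) = conv_radius (\<lambda>n. (-1) ^ n * (\<gamma> gchoose n))"
    by (simp add: fps_conv_radius_def gbinomial_pochhammer mult.assoc [symmetric] flip: power_add)
  also have "\<dots> = fps_conv_radius (fps_binomial \<gamma>)"
    unfolding fps_conv_radius_def
    by (intro conv_radius_cong always_eventually) (simp add: norm_mult norm_power)
  also have "\<dots> \<ge> 1" by (simp add: fps_conv_radius_binomial)
  finally show ?thesis .
qed

lemma eval_fps_one_minus_X_powr:
  assumes "norm z < 1"
  shows "eval_fps (one_minus_X_powr \<gamma>) z = (1 - z) powr \<gamma>"
proof -
  have "(\<lambda>n. (\<gamma> gchoose n) * (- z) ^ n) sums (1 - z) powr \<gamma>"
    using gen_binomial_complex [of "- z" \<gamma>] assms by simp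
  also have "(\<lambda>n. (\<gamma> gchoose n) * (- z) ^ n) = (\<lambda>n. one_minus_X_powr \<gamma> $ n * z ^ n)"
  proof
    fix n
    have "(-1) ^ n * (- z) ^ n = z ^ n" by (simp flip: power_mult_distrib)
    thus "(\<gamma> gchoose n) * (- z) ^ n = one_minus_X_powr \<gamma> $ n * z ^ n"
      by (simp add: gbinomial_pochhammer)
  qed
  finally show ?thesis by (simp add: sums_iff eval_fps_def)
qed

lemma fps_XDp_conv_eval:
  assumes "fps_conv_radius F \<ge> 1"
  shows "fps_conv_radius (fps_XDp c F) \<ge> (1 :: ereal)"
    and "norm z < 1 \<Longrightarrow> eval_fps (fps_XDp c F) z = z * eval_fps (fps_deriv F) z + c * eval_fps F (z::complex)"
proof -
  have D: "fps_conv_radius (fps_deriv F) \<ge> 1"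
    using assms fps_conv_radius_deriv [of F] by order
  have XD: "fps_conv_radius (fps_X * fps_deriv F) \<ge> 1"
    using D fps_conv_radius_mult [of fps_X "fps_deriv F"] by (simp add: min_def split: if_splits)
  have C: "fps_conv_radius (fps_const c * F) \<ge> 1"
    using assms fps_conv_radius_mult [of "fps_const c" F] by (simp add: min_def split: if_splits)
  have e: "fps_XDp c F = fps_X * fps_deriv F + fps_const c * F"
    by (simp add: fps_XDp_def fps_XD_def)
  show "fps_conv_radius (fps_XDp c F) \<ge> 1"
    unfolding e using XD C fps_conv_radius_add order.trans min.boundedI by meson
  assume z: "norm z < 1"
  hence z': "ereal (norm z) < r" if "1 \<le> r" for r
    using that by (meson ereal_less(3) order.strict_trans2)
  show "eval_fps (fps_XDp c F) z = z * eval_fps (fps_deriv F) z + c * eval_fps F z"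
    unfolding e using z' [OF XD] z' [OF C] z' [OF D] z' [OF assms]
    by (simp add: eval_fps_add eval_fps_mult)
qed

text \<open>
  An open set on which the power series converge and the principal powers of \<open>u\<close> are holomorphic.
  Openness matters because the inner functions of the Rodrigues formula enter through their
  derivatives, so that they must be known near each point and not only on \<open>(0,1)\<close>.
\<close>

definition slit_disc :: "complex set" where "slit_disc = ball 0 1 - \<real>\<^sub>\<le>\<^sub>0"

lemma open_slit_disc: "open slit_disc"
  by (simp add: slit_disc_def open_Diff)

text \<open>
  The innermost derivative turns \<open>v\<^sup>n\<^sup>+\<^sup>1\<^sup>+\<^sup>\<alpha> F\<close> into \<open>v\<^sup>n\<^sup>+\<^sup>\<alpha> (v F' + (\<alpha>+n+1) F)\<close>, which is of the same form with
  one derivative less.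
\<close>

lemma higher_deriv_powr_times_eval_fps:
  assumes "fps_conv_radius F \<ge> 1" "u \<in> slit_disc"
  shows "(deriv ^^ n) (\<lambda>v. v powr (of_nat n + \<alpha>) * eval_fps F v) u =
     u powr \<alpha> * eval_fps (rodrigues_fps n \<alpha> F) u"
  using assms
proof (induction n arbitrary: F)
  case 0
  show ?case by simp
next
  case (Suc n)
  let ?F = "fps_XDp (\<alpha> + of_nat n + 1) F"
  let ?s = "of_nat (Suc n) + \<alpha>"
  have deriv: "deriv (\<lambda>v. v powr ?s * eval_fps F v) v = v powr (of_nat n + \<alpha>) * eval_fps ?F v"
    if v: "v \<in> slit_disc" for v
  proof -
    have v': "v \<noteq> 0" "norm v < 1" "v \<notin> \<real>\<^sub>\<le>\<^sub>0" using v by (auto simp: slit_disc_def)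
    hence r: "ereal (norm v) < fps_conv_radius F"
      using Suc.prems(1) by (meson ereal_less(3) order.strict_trans2)
    have "?s = of_nat n + \<alpha> + 1" by simp
    hence pw: "v powr ?s = v powr (of_nat n + \<alpha>) * v"
      by (simp only: powr_add) (use v' in simp)
    have "((\<lambda>v. v powr ?s * eval_fps F v) has_field_derivative
        v powr ?s * eval_fps (fps_deriv F) v + ?s * v powr (?s - 1) * eval_fps F v) (at v)"
      by (rule DERIV_mult' [OF has_field_derivative_powr [OF v'(3)] has_field_derivative_eval_fps [OF r]])
    hence "deriv (\<lambda>v. v powr ?s * eval_fps F v) v =
        v powr ?s * eval_fps (fps_deriv F) v + ?s * v powr (?s - 1) * eval_fps F v"
      by (rule DERIV_imp_deriv)
    also have "?s - 1 = of_nat n + \<alpha>" by simp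
    finally show ?thesis
      unfolding pw fps_XDp_conv_eval(2) [OF Suc.prems(1) v'(2)] by (simp add: algebra_simps)
  qed
  have "(deriv ^^ Suc n) (\<lambda>v. v powr ?s * eval_fps F v) u =
      (deriv ^^ n) (deriv (\<lambda>v. v powr ?s * eval_fps F v)) u"
    by (simp only: funpow_Suc_right o_def)
  also have "\<dots> = (deriv ^^ n) (\<lambda>v. v powr (of_nat n + \<alpha>) * eval_fps ?F v) u"
    using eventually_nhds_in_open [OF open_slit_disc Suc.prems(2)]
    by (intro higher_deriv_cong_ev refl) (auto elim!: eventually_mono simp: deriv simp del: of_nat_Suc)
  also have "\<dots> = u powr \<alpha> * eval_fps (rodrigues_fps n \<alpha> ?F) u"
    by (rule Suc.IH [OF fps_XDp_conv_eval(1) [OF Suc.prems(1)] Suc.prems(2)])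
  finally show ?case unfolding rodrigues_fps_Suc' .
qed

lemma fps_conv_radius_rodrigues_fps:
  assumes "fps_conv_radius F \<ge> 1"
  shows "fps_conv_radius (rodrigues_fps n \<alpha> F) \<ge> 1"
proof (induction n)
  case 0
  show ?case using assms by simp
next
  case (Suc n)
  thus ?case unfolding rodrigues_fps_Suc by (rule fps_XDp_conv_eval(1))
qed

lemma rodrigues_op_eval_fps:
  assumes "fps_conv_radius F \<ge> 1" "\<And>v. v \<in> slit_disc \<Longrightarrow> f v = eval_fps F v" "u \<in> slit_disc"
  shows "rodrigues_op n \<alpha> f u = eval_fps (rodrigues_fps n \<alpha> F) u"
proof -
  have "(deriv ^^ n) (\<lambda>v. v powr (of_nat n + \<alpha>) * f v) u =
      (deriv ^^ n) (\<lambda>v. v powr (of_nat n + \<alpha>) * eval_fps F v) u"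
    using eventually_nhds_in_open [OF open_slit_disc assms(3)]
    by (intro higher_deriv_cong_ev refl) (auto elim!: eventually_mono simp: assms(2))
  also have "\<dots> = u powr \<alpha> * eval_fps (rodrigues_fps n \<alpha> F) u"
    by (rule higher_deriv_powr_times_eval_fps [OF assms(1,3)])
  finally have "rodrigues_op n \<alpha> f u = u powr (- \<alpha>) * u powr \<alpha> * eval_fps (rodrigues_fps n \<alpha> F) u"
    by (simp add: rodrigues_op_def)
  also have "u powr (- \<alpha>) * u powr \<alpha> = 1"
    using assms(3) by (cases "u = 0") (auto simp: slit_disc_def powr_minus)
  finally show ?thesis by simp
qed

lemma foldr_rodrigues_op_eval_fps:
  assumes "fps_conv_radius F \<ge> 1" "\<And>v. v \<in> slit_disc \<Longrightarrow> f v = eval_fps F v" "distinct js"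
  shows "fps_conv_radius (multi_rodrigues_fps (set js) n \<alpha> F) \<ge> 1 \<and>
    (\<forall>u\<in>slit_disc. foldr (\<lambda>j. rodrigues_op (n j) (\<alpha> j)) js f u =
       eval_fps (multi_rodrigues_fps (set js) n \<alpha> F) u)"
  using assms(3)
proof (induction js)
  case Nil
  show ?case using assms(1,2) by simp
next
  case (Cons j js)
  thus ?case
    by (auto simp: multi_rodrigues_fps_insert fps_conv_radius_rodrigues_fps
        intro!: rodrigues_op_eval_fps)
qed

lemma jacobi_pineiro_eq_poly:
  assumes "fps_of_poly P = jacobi_pineiro_fps m n \<alpha> \<beta>" "0 < x" "x < (1::real)"
  shows "jacobi_pineiro m n \<alpha> \<beta> (of_real x) = poly P (of_real x)"
proof -
  let ?N = "\<Sum>j=1..m. n j"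
  let ?G = "multi_rodrigues_fps {1..m} n \<alpha> (one_minus_X_powr (of_nat ?N + \<beta>))"
  let ?u = "complex_of_real x"
  have u: "?u \<in> slit_disc" "norm ?u < 1" using assms(2,3) by (auto simp: slit_disc_def)
  have *: "fps_conv_radius (multi_rodrigues_fps (set [1..<Suc m]) n \<alpha> (one_minus_X_powr (of_nat ?N + \<beta>))) \<ge> 1 \<and>
    (\<forall>u\<in>slit_disc. foldr (\<lambda>j. rodrigues_op (n j) (\<alpha> j)) [1..<Suc m] (\<lambda>v. (1 - v) powr (of_nat ?N + \<beta>)) u =
       eval_fps (multi_rodrigues_fps (set [1..<Suc m]) n \<alpha> (one_minus_X_powr (of_nat ?N + \<beta>))) u)"
    by (rule foldr_rodrigues_op_eval_fps)
       (auto simp: fps_conv_radius_one_minus_X_powr eval_fps_one_minus_X_powr slit_disc_def simp del: upt_Suc)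
  have set: "set [1..<Suc m] = {1..m}" by auto
  have r: "ereal (norm ?u) < r" if "1 \<le> r" for r
    using that u(2) by (meson ereal_less(3) order.strict_trans2)
  have G: "fps_conv_radius ?G \<ge> 1" using * unfolding set by blast
  have B: "fps_conv_radius (one_minus_X_powr (- \<beta>)) \<ge> 1" by (rule fps_conv_radius_one_minus_X_powr)
  have BG: "fps_conv_radius (one_minus_X_powr (- \<beta>) * ?G) \<ge> 1"
    using G B fps_conv_radius_mult order.trans min.boundedI by meson
  have "poly P ?u = eval_fps (jacobi_pineiro_fps m n \<alpha> \<beta>) ?u"
    using assms(1) by (metis eval_fps_of_poly)
  also have "\<dots> = 1 / (\<Prod>j=1..m. fact (n j)) * ((1 - ?u) powr (- \<beta>) * eval_fps ?G ?u)"
    unfolding jacobi_pineiro_fps_def using r [OF BG] r [OF B] r [OF G] u(2)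
    by (simp add: eval_fps_mult eval_fps_one_minus_X_powr del: of_nat_sum)
  also have "eval_fps ?G ?u = foldr (\<lambda>j. rodrigues_op (n j) (\<alpha> j)) [1..<Suc m]
      (\<lambda>v. (1 - v) powr (of_nat ?N + \<beta>)) ?u"
    using * u(1) unfolding set by simp
  finally show ?thesis unfolding jacobi_pineiro_def by (simp only: mult.assoc)
qed

section \<open>Well-definedness of the expansion coefficients\<close>

lemma pochhammer_nonpos_Ints_nonzero:
  "x \<notin> \<int>\<^sub>\<le>\<^sub>0 \<Longrightarrow> pochhammer x k \<noteq> (0::complex)"
  by (auto simp: pochhammer_eq_0_iff)

lemma euler_coeff_conv_pochhammer:
  assumes "x \<notin> \<int>\<^sub>\<le>\<^sub>0"
  shows "euler_coeff n x \<gamma> k =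
    pochhammer x n * (pochhammer (- of_nat n) k * pochhammer (x + \<gamma>) k / (pochhammer x k * fact k))"
proof (cases "k \<le> n")
  case True
  have "(-1) ^ k * of_nat (n choose k) = (pochhammer (- of_nat n) k / fact k :: complex)"
    using True by (simp add: binomial_gbinomial gbinomial_pochhammer mult.assoc [symmetric]
        flip: power_add)
  moreover have "pochhammer x n = pochhammer x k * pochhammer (x + of_nat k) (n - k)"
    using True by (rule pochhammer_product)
  ultimately show ?thesis
    using pochhammer_nonpos_Ints_nonzero [OF assms, of k] by (simp add: euler_coeff_def)
next
  case False
  thus ?thesis by (simp add: euler_coeff_def pochhammer_of_nat_eq_0_lemma binomial_eq_0)
qed

lemma terminating_hypergeom:
  "hypergeom (- of_nat l # as) bs z = (\<Sum>k\<le>l. fps_hypergeo (- of_nat l # as) bs 1 $ k * z ^ k)"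
proof -
  have "foldl (\<lambda>r a. r * f a) 0 xs = 0" for f :: "complex \<Rightarrow> complex" and xs
    by (induction xs) auto
  hence "fps_hypergeo (- of_nat l # as) bs 1 $ k = 0" if "k > l" for k
    using that by (simp add: pochhammer_of_nat_eq_0_lemma)
  thus ?thesis
    unfolding hypergeom_def eval_fps_def by (intro suminf_finite) (auto simp: not_le)
qed

lemma jacobi_eq_poly:
  assumes "\<alpha> + 1 \<notin> \<int>\<^sub>\<le>\<^sub>0"
  shows "jacobi l \<alpha> \<beta> u = poly (jacobi_poly l \<alpha> \<beta>) u"
  unfolding jacobi_def terminating_hypergeom jacobi_poly_def poly_sum poly_monom
    euler_coeff_conv_pochhammer [OF assms]
  by (simp add: sum_distrib_left sum_distrib_right add_ac mult_ac)

lemma poly_eq_of_eq_on_unit_interval: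
  fixes p q :: "complex poly"
  assumes "\<And>x::real. 0 < x \<Longrightarrow> x < 1 \<Longrightarrow> poly p (of_real x) = poly q (of_real x)"
  shows "p = q"
proof (rule ccontr)
  assume "p \<noteq> q"
  hence "finite {z. poly (p - q) z = 0}" by (intro poly_roots_finite) simp
  moreover have "of_real ` {0<..<1} \<subseteq> {z. poly (p - q) z = 0}" using assms by auto
  ultimately have "finite (complex_of_real ` {0<..<1})" by (rule rev_finite_subset)
  hence "finite {0<..<1::real}" by (rule finite_imageD) (simp add: inj_on_def)
  thus False using infinite_Ioo [of 0 "1::real"] by simp
qed

text \<open>
  The definite description in \<^const>\<open>jp_coeff\<close> denotes: coefficients exist because \<open>P\<close> lies in the span
  of the Jacobi polynomials in question, and they are unique because an equation between polynomials
  on \<open>(0,1)\<close> is an identity of polynomials and the Jacobi polynomials are linearly independent.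
\<close>

lemma jacobi_pineiro_poly_expansion:
  assumes j: "j \<in> {1..m}" and \<alpha>: "\<alpha> j + 1 \<notin> \<int>\<^sub>\<le>\<^sub>0" and \<alpha>\<beta>: "\<alpha> j + \<beta> + 2 \<notin> \<int>\<^sub>\<le>\<^sub>0"
    and P: "fps_of_poly P = jacobi_pineiro_fps m n \<alpha> \<beta>"
  shows "P = (\<Sum>l = n j..\<Sum>i=1..m. n i. smult (jp_coeff m n \<alpha> \<beta> j l) (jacobi_poly l (\<alpha> j) \<beta>))"
proof -
  define N where "N = (\<Sum>i=1..m. n i)"
  define B where "B l = jacobi_poly l (\<alpha> j) \<beta>" for l
  \<comment> \<open>the predicate inside the definite description\<close>
  define expands where "expands C \<longleftrightarrow> (\<forall>l. l \<notin> {n j..N} \<longrightarrow> C l = 0) \<and>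
     (\<forall>u::real. 0 < u \<and> u < 1 \<longrightarrow> jacobi_pineiro m n \<alpha> \<beta> (of_real u) =
        (\<Sum>l = n j..N. C l * jacobi l (\<alpha> j) \<beta> (of_real u)))" for C
  have expands_iff: "expands C \<longleftrightarrow> (\<forall>l. l \<notin> {n j..N} \<longrightarrow> C l = 0) \<and>
      P = (\<Sum>l = n j..N. smult (C l) (B l))" for C
  proof -
    have "(\<forall>u::real. 0 < u \<and> u < 1 \<longrightarrow> jacobi_pineiro m n \<alpha> \<beta> (of_real u) =
        (\<Sum>l = n j..N. C l * jacobi l (\<alpha> j) \<beta> (of_real u))) \<longleftrightarrow>
      (\<forall>u::real. 0 < u \<and> u < 1 \<longrightarrow> poly P (of_real u) =
        poly (\<Sum>l = n j..N. smult (C l) (B l)) (of_real u))"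
      by (simp add: jacobi_pineiro_eq_poly [OF P] jacobi_eq_poly [OF \<alpha>] B_def poly_sum)
    also have "\<dots> \<longleftrightarrow> P = (\<Sum>l = n j..N. smult (C l) (B l))"
      using poly_eq_of_eq_on_unit_interval by blast
    finally show ?thesis unfolding expands_def by simp
  qed
  have unique: "C = C'" if C: "expands C" and C': "expands C'" for C C'
  proof
    fix l
    have B: "degree (B k) \<le> k" "coeff (B k) k \<noteq> 0" for k
      unfolding B_def by (rule degree_jacobi_poly, rule coeff_degree_jacobi_poly [OF \<alpha>\<beta>])
    have "(\<Sum>k\<le>N. smult (C k - C' k) (B k)) = (\<Sum>k = n j..N. smult (C k - C' k) (B k))"
      using C C' unfolding expands_iff by (intro sum.mono_neutral_right) auto
    also have "\<dots> = (\<Sum>k = n j..N. smult (C k) (B k)) - (\<Sum>k = n j..N. smult (C' k) (B k))"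
      by (simp add: sum_subtractf smult_diff_left)
    also have "\<dots> = 0" using C C' unfolding expands_iff by simp
    finally have "C l - C' l = 0" if "l \<le> N"
      using triangular_poly_independent [where B = B and M = N and c = "\<lambda>k. C k - C' k" and k = l] B that by blast
    thus "C l = C' l" using C C' unfolding expands_iff by (cases "l \<le> N") auto
  qed
  obtain c where "jacobi_pineiro_fps m n \<alpha> \<beta> = fps_of_poly (\<Sum>l = n j..N. smult (c l) (B l))"
    unfolding N_def B_def by (rule jacobi_pineiro_fps_jacobi_span [where j = j and \<alpha> = \<alpha> and \<beta> = \<beta>, OF j \<alpha>\<beta>])
  hence "expands (\<lambda>l. if l \<in> {n j..N} then c l else 0)"
    unfolding expands_iff P [symmetric] by (simp add: fps_of_poly_eq_iff)
  hence "\<exists>!C. expands C" using unique by blast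
  hence "expands (THE C. expands C)" by (rule theI')
  also have "(THE C. expands C) = jp_coeff m n \<alpha> \<beta> j"
    unfolding jp_coeff_def expands_def N_def ..
  finally show ?thesis unfolding expands_iff B_def N_def by blast
qed

section \<open>From Jacobi-Pineiro to multiple Wilson polynomials\<close>

text \<open>
  The linear map \<open>u\<^sup>k \<mapsto> (a-t)\<^sub>k (a+t)\<^sub>k / ((a+c)\<^sub>k (a+d)\<^sub>k)\<close>. For polynomials of degree at most \<open>N\<close> the sum
  covers all coefficients; the fixed bound makes the map linear by construction.
\<close>

definition wilson_transform ::
  "nat \<Rightarrow> complex \<Rightarrow> complex \<Rightarrow> complex \<Rightarrow> complex \<Rightarrow> complex poly \<Rightarrow> complex" where
  "wilson_transform N a c d t Q = (\<Sum>k\<le>N. coeff Q k *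
     (pochhammer (a - t) k * pochhammer (a + t) k / (pochhammer (a + c) k * pochhammer (a + d) k)))"

lemma wilson_transform_sum_smult:
  "wilson_transform N a c d t (\<Sum>l\<in>A. smult (f l) (Q l)) =
     (\<Sum>l\<in>A. f l * wilson_transform N a c d t (Q l))"
  unfolding wilson_transform_def coeff_sum coeff_smult sum_distrib_right sum_distrib_left
  by (subst sum.swap) (simp add: mult_ac)

lemma wilson_transform_monom:
  assumes "k \<le> N"
  shows "wilson_transform N a c d t (monom 1 k) =
     pochhammer (a - t) k * pochhammer (a + t) k / (pochhammer (a + c) k * pochhammer (a + d) k)"
    (is "_ = ?\<phi> k")
proof -
  have "wilson_transform N a c d t (monom 1 k) = (\<Sum>i\<le>N. if k = i then ?\<phi> i else 0)"
    unfolding wilson_transform_def by (intro sum.cong) auto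
  thus ?thesis using assms by simp
qed

lemma wilson_sq_eq_transform:
  assumes "a + b \<notin> \<int>\<^sub>\<le>\<^sub>0" "l \<le> N"
  shows "wilson_sq l a b c d t = fact l * (pochhammer (a + c) l * pochhammer (a + d) l *
     wilson_transform N a c d t (jacobi_poly l (a + b - 1) (c + d - 1)))"
proof -
  let ?Q = "jacobi_poly l (a + b - 1) (c + d - 1)"
  have "wilson_transform N a c d t ?Q = (\<Sum>k\<le>l. coeff ?Q k * (pochhammer (a - t) k *
      pochhammer (a + t) k / (pochhammer (a + c) k * pochhammer (a + d) k)))"
    unfolding wilson_transform_def using assms(2)
    by (intro sum.mono_neutral_right) (auto simp: coeff_jacobi_poly euler_coeff_def binomial_eq_0)
  also have "\<dots> = pochhammer (a + b) l / fact l *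
    hypergeom [- of_nat l, a + b + c + d + of_nat l - 1, a - t, a + t] [a + b, a + c, a + d] 1"
    unfolding terminating_hypergeom sum_distrib_left coeff_jacobi_poly
    using assms(1) by (intro sum.cong) (simp_all add: euler_coeff_conv_pochhammer algebra_simps)
  finally show ?thesis by (simp add: wilson_sq_def)
qed

text \<open>
  In the summand with index \<open>l\<close>, the factor \<open>(a+c)\<^sub>l (a+d)\<^sub>l\<close> from the Wilson polynomial completes the
  weight to \<open>(a+c)\<^sub>N (a+d)\<^sub>N\<close>. So the sum is the transform of the Jacobi expansion of \<open>P\<close>, and \<open>j\<close>
  disappears.
\<close>

lemma wilson_expansion_eq_transform:
  assumes j: "j \<in> {1..m}" and "a + b j \<notin> \<int>\<^sub>\<le>\<^sub>0" "a + b j + c + d \<notin> \<int>\<^sub>\<le>\<^sub>0"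
    and P: "fps_of_poly P = jacobi_pineiro_fps m n (\<lambda>i. a + b i - 1) (c + d - 1)"
  defines "N \<equiv> \<Sum>i=1..m. n i"
  shows "wilson_expansion m n a b c d j t = (\<Prod>i=1..m. fact (n i)) *
     (pochhammer (a + c) N * pochhammer (a + d) N * wilson_transform N a c d t P)"
proof -
  let ?C = "jp_coeff m n (\<lambda>i. a + b i - 1) (c + d - 1) j"
  let ?Q = "\<lambda>l. jacobi_poly l (a + b j - 1) (c + d - 1)"
  have split: "pochhammer x N = pochhammer x l * pochhammer (x + of_nat l) (N - l)"
    if "l \<le> N" for x :: complex and l using that by (rule pochhammer_product)
  have P_eq: "P = (\<Sum>l = n j..N. smult (?C l) (?Q l))"
    unfolding N_def using assms(2,3)
    by (intro jacobi_pineiro_poly_expansion [OF j _ _ P]) (simp_all add: algebra_simps)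
  have "wilson_expansion m n a b c d j t = (\<Sum>l = n j..N. (\<Prod>i=1..m. fact (n i)) *
     (pochhammer (a + c) N * pochhammer (a + d) N * (?C l * wilson_transform N a c d t (?Q l))))"
    unfolding wilson_expansion_def Let_def N_def [symmetric]
  proof (intro sum.cong refl)
    fix l assume "l \<in> {n j..N}"
    hence l: "l \<le> N" by simp
    show "(\<Prod>i=1..m. fact (n i)) / fact l * pochhammer (a + c + of_nat l) (N - l) *
        pochhammer (a + d + of_nat l) (N - l) * ?C l * wilson_sq l a (b j) c d t =
      (\<Prod>i=1..m. fact (n i)) *
        (pochhammer (a + c) N * pochhammer (a + d) N * (?C l * wilson_transform N a c d t (?Q l)))"
      unfolding wilson_sq_eq_transform [OF assms(2) l] split [OF l] by simp
  qed
  also have "\<dots> = (\<Prod>i=1..m. fact (n i)) *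
     (pochhammer (a + c) N * pochhammer (a + d) N * wilson_transform N a c d t P)"
    by (subst P_eq) (simp add: wilson_transform_sum_smult sum_distrib_left)
  finally show ?thesis .
qed

text \<open>
  This rests on \<open>(a-t)\<^sub>k (a+t)\<^sub>k = \<Prod>\<^sub>i\<^sub><\<^sub>k ((a+i)\<^sup>2 - t\<^sup>2)\<close>.
\<close>

lemma wilson_transform_poly_in_square:
  obtains p where "\<And>t. poly p (t\<^sup>2) = wilson_transform N a c d t Q"
proof
  fix t
  have prod: "pochhammer (a - t) k * pochhammer (a + t) k =
      poly (\<Prod>i<k. [:(a + of_nat i)\<^sup>2, -1:]) (t\<^sup>2)" for k
    by (simp add: pochhammer_prod poly_prod prod.distrib [symmetric] atLeast0LessThan
        power2_eq_square algebra_simps)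
  show "poly (\<Sum>k\<le>N. smult (coeff Q k / (pochhammer (a + c) k * pochhammer (a + d) k))
      (\<Prod>i<k. [:(a + of_nat i)\<^sup>2, -1:])) (t\<^sup>2) = wilson_transform N a c d t Q"
    by (simp add: wilson_transform_def poly_sum prod)
qed

lemma multiple_wilson_eq_transform:
  assumes "m \<ge> 1" "\<And>j. j \<in> {1..m} \<Longrightarrow> a + b j \<notin> \<int>\<^sub>\<le>\<^sub>0"
    and "\<And>j. j \<in> {1..m} \<Longrightarrow> a + b j + c + d \<notin> \<int>\<^sub>\<le>\<^sub>0"
    and P: "fps_of_poly P = jacobi_pineiro_fps m n (\<lambda>i. a + b i - 1) (c + d - 1)"
  defines "N \<equiv> \<Sum>i=1..m. n i"
  shows "poly (multiple_wilson m n a b c d) (t\<^sup>2) = (\<Prod>i=1..m. fact (n i)) *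
     (pochhammer (a + c) N * pochhammer (a + d) N * wilson_transform N a c d t P)"
proof -
  obtain p where p: "\<And>t. poly p (t\<^sup>2) = wilson_transform N a c d t P"
    using wilson_transform_poly_in_square [where N = N and a = a and c = c and d = d and Q = P]
    by blast
  let ?p = "smult ((\<Prod>i=1..m. fact (n i)) * (pochhammer (a + c) N * pochhammer (a + d) N)) p"
  have "wilson_normalized m n a b c d ?p"
    unfolding wilson_normalized_def
    using wilson_expansion_eq_transform [OF _ _ _ P] assms(2,3)
    by (simp add: p N_def mult.assoc del: atLeastAtMost_iff)
  hence "multiple_wilson m n a b c d = ?p"
    unfolding multiple_wilson_def
    by (intro the_equality wilson_normalized_unique [OF assms(1)])
  thus ?thesis by (simp add: p)
qed

section \<open>The two hypergeometric representations\<close>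

lemma sum_PiE_insert:
  assumes "x \<notin> S"
  shows "(\<Sum>k\<in>PiE (insert x S) A. f k) = (\<Sum>k\<in>PiE S A. \<Sum>y\<in>A x. f (k(x := y)))"
proof -
  have "(\<Sum>k\<in>PiE (insert x S) A. f k) = (\<Sum>(y, k)\<in>A x \<times> PiE S A. f (k(x := y)))"
    unfolding PiE_insert_eq sum.reindex [OF inj_combinator [OF assms]]
    by (simp add: o_def case_prod_beta)
  also have "\<dots> = (\<Sum>y\<in>A x. \<Sum>k\<in>PiE S A. f (k(x := y)))"
    by (simp add: sum.cartesian_product)
  finally show ?thesis by (subst sum.swap)
qed

text \<open>
  The operators are applied in the order \<open>m, m-1, \<dots>, i+1\<close>. When the operator with index \<open>j\<close> acts,
  the exponent of \<open>1-u\<close> has been lowered to \<open>s\<^sub>j + \<beta>\<close> and the power of \<open>u\<close> has been raised to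
  \<open>K\<^sub>j = k\<^sub>j\<^sub>+\<^sub>1 + \<dots> + k\<^sub>m\<close>, which accounts for the parameters of its \<^const>\<open>euler_coeff\<close>.
\<close>

lemma multi_rodrigues_fps_expansion:
  fixes n :: "nat \<Rightarrow> nat" and \<alpha> :: "nat \<Rightarrow> complex" and \<beta> :: complex and m :: nat
  defines "s \<equiv> \<lambda>j. \<Sum>i=1..j. n i"
  defines "K \<equiv> \<lambda>k i. \<Sum>j=i+1..m. k j"
  assumes "i \<le> m"
  shows "multi_rodrigues_fps {i+1..m} n \<alpha> (one_minus_X_powr (of_nat (s m) + \<beta>)) =
    one_minus_X_powr (of_nat (s i) + \<beta>) *
    (\<Sum>k \<in> (\<Pi>\<^sub>E j\<in>{i+1..m}. {0..n j}).
       fps_const (\<Prod>j=i+1..m. euler_coeff (n j) (\<alpha> j + 1 + of_nat (K k j)) (of_nat (s j) + \<beta>) (k j)) *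
       fps_X ^ K k i)"
  using assms(3)
proof (induction i rule: inc_induct)
  case base
  show ?case by (simp add: K_def)
next
  case (step i)
  let ?j = "Suc i" and ?A = "\<lambda>j. {0..n j}"
  let ?e = "\<lambda>k j. euler_coeff (n j) (\<alpha> j + 1 + of_nat (K k j)) (of_nat (s j) + \<beta>) (k j)"
  let ?\<gamma> = "of_nat (s ?j) + \<beta>"
  have ins: "{i+1..m} = insert ?j {?j+1..m}" using step.hyps by auto
  have s: "of_nat (s ?j) + \<beta> - of_nat (n ?j) = of_nat (s i) + \<beta>" by (simp add: s_def)
  have "multi_rodrigues_fps {i+1..m} n \<alpha> (one_minus_X_powr (of_nat (s m) + \<beta>)) =
      rodrigues_fps (n ?j) (\<alpha> ?j) (one_minus_X_powr ?\<gamma> *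
        (\<Sum>k\<in>PiE {?j+1..m} ?A. fps_const (\<Prod>j=?j+1..m. ?e k j) * fps_X ^ K k ?j))"
    unfolding ins by (subst multi_rodrigues_fps_insert) (simp_all only: step.IH finite_atLeastAtMost, simp)
  also have "\<dots> = (\<Sum>k\<in>PiE {?j+1..m} ?A. fps_const (\<Prod>j=?j+1..m. ?e k j) *
      rodrigues_fps (n ?j) (\<alpha> ?j) (fps_X ^ K k ?j * one_minus_X_powr ?\<gamma>))"
    unfolding sum_distrib_left rodrigues_fps_sum
    by (intro sum.cong refl) (subst rodrigues_fps_const_mult [symmetric], simp only: mult_ac)
  also have "\<dots> = one_minus_X_powr (of_nat (s i) + \<beta>) *
      (\<Sum>k\<in>PiE {?j+1..m} ?A. \<Sum>y\<in>?A ?j. fps_const (\<Prod>j=?j+1..m. ?e k j) *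
         (fps_const (euler_coeff (n ?j) (\<alpha> ?j + 1 + of_nat (K k ?j)) ?\<gamma> y) * fps_X ^ (K k ?j + y)))"
    unfolding rodrigues_fps_X_power_mult s atLeast0AtMost
    by (simp add: sum_distrib_left mult.left_commute)
  also have "(\<Sum>k\<in>PiE {?j+1..m} ?A. \<Sum>y\<in>?A ?j. fps_const (\<Prod>j=?j+1..m. ?e k j) *
         (fps_const (euler_coeff (n ?j) (\<alpha> ?j + 1 + of_nat (K k ?j)) ?\<gamma> y) * fps_X ^ (K k ?j + y))) =
      (\<Sum>k\<in>PiE {?j+1..m} ?A. \<Sum>y\<in>?A ?j. fps_const (\<Prod>j=i+1..m. ?e (k(?j := y)) j) *
         fps_X ^ K (k(?j := y)) i)"
  proof (intro sum.cong refl)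
    fix k :: "nat \<Rightarrow> nat" and y
    have K: "K (k(?j := y)) j = K k j" if "j \<ge> ?j" for j
      unfolding K_def using that by (intro sum.cong) auto
    have Ki: "K (k(?j := y)) i = K k ?j + y"
    proof -
      have "K (k(?j := y)) i = y + (\<Sum>j=?j+1..m. (k(?j := y)) j)"
        unfolding K_def ins by (subst sum.insert) auto
      also have "(\<Sum>j=?j+1..m. (k(?j := y)) j) = K k ?j"
        unfolding K_def by (intro sum.cong) auto
      finally show ?thesis by (simp only: add.commute)
    qed
    have "(\<Prod>j=?j+1..m. ?e (k(?j := y)) j) = (\<Prod>j=?j+1..m. ?e k j)"
      by (intro prod.cong) (auto simp: K)
    hence "(\<Prod>j=i+1..m. ?e (k(?j := y)) j) =
        euler_coeff (n ?j) (\<alpha> ?j + 1 + of_nat (K k ?j)) ?\<gamma> y * (\<Prod>j=?j+1..m. ?e k j)"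
      unfolding ins by (subst prod.insert) (auto simp: K)
    thus "fps_const (\<Prod>j=?j+1..m. ?e k j) *
        (fps_const (euler_coeff (n ?j) (\<alpha> ?j + 1 + of_nat (K k ?j)) ?\<gamma> y) * fps_X ^ (K k ?j + y)) =
        fps_const (\<Prod>j=i+1..m. ?e (k(?j := y)) j) * fps_X ^ K (k(?j := y)) i"
      unfolding Ki by (simp add: mult_ac flip: fps_const_mult)
  qed
  also have "\<dots> = (\<Sum>k \<in> PiE {i+1..m} ?A. fps_const (\<Prod>j=i+1..m. ?e k j) * fps_X ^ K k i)"
    unfolding ins by (subst sum_PiE_insert) auto
  finally show ?case .
qed

lemma pochhammer_nz_nonzero: "pochhammer_nz x k \<noteq> 0"
  unfolding pochhammer_nz_def by (subst prod_zero_iff) auto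

lemma pochhammer_conv_pochhammer_nz:
  assumes "\<And>i. K \<le> i \<Longrightarrow> i < K + k \<Longrightarrow> x + of_nat i \<noteq> 0"
  shows "pochhammer (x + of_nat K) k = pochhammer_nz x (K + k) / pochhammer_nz x K"
proof -
  have "{i. i < K + k \<and> x + of_nat i \<noteq> 0} = {i. i < K \<and> x + of_nat i \<noteq> 0} \<union> {K..<K + k}"
    using assms by auto
  hence "pochhammer_nz x (K + k) = pochhammer_nz x K * (\<Prod>i=K..<K + k. x + of_nat i)"
    unfolding pochhammer_nz_def by (simp add: prod.union_disjoint disjoint_iff)
  also have "(\<Prod>i=K..<K + k. x + of_nat i) = pochhammer (x + of_nat K) k"
    using prod.shift_bounds_nat_ivl [of "\<lambda>i. x + of_nat i" 0 K k]
    by (simp add: pochhammer_prod add_ac)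
  finally show ?thesis using pochhammer_nz_nonzero [of x K] by simp
qed

text \<open>
  For factors \<open>f\<^sub>j\<close> that depend on \<open>K\<^sub>j\<close> and \<open>g\<^sub>j\<close> that depend on \<open>K\<^sub>j\<^sub>-\<^sub>1\<close>, this collects the factors with
  the same \<open>K\<^sub>i\<close>.
\<close>

lemma prod_shift_split:
  fixes f g :: "nat \<Rightarrow> 'a::comm_monoid_mult"
  shows "(\<Prod>j=1..Suc m. f j * g j) = f (Suc m) * g 1 * (\<Prod>i=1..m. f i * g (i + 1))"
  by (induction m) (simp_all add: mult_ac)

text \<open>
  The symbols with base \<open>x + K\<close> are split into quotients of symbols with base independent of \<open>K\<close>,
  grouped so that the first factor in the large parentheses depends on \<open>K = K\<^sub>j\<close> only and the second
  one on \<open>K + k = K\<^sub>j\<^sub>-\<^sub>1\<close> only.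
\<close>

lemma euler_coeff_shifted:
  assumes x: "x \<notin> \<int>\<^sub>\<le>\<^sub>0"
    and y: "\<And>i. K \<le> i \<Longrightarrow> i < K + k \<Longrightarrow> x + \<gamma> + of_nat i \<noteq> 0"
  shows "euler_coeff n (x + of_nat K) \<gamma> k = pochhammer x n * (pochhammer (- of_nat n) k / fact k) *
     ((pochhammer (x + of_nat n) K / pochhammer_nz (x + \<gamma>) K) *
      (pochhammer_nz (x + \<gamma>) (K + k) / pochhammer x (K + k)))"
proof -
  have xK: "x + of_nat K \<notin> \<int>\<^sub>\<le>\<^sub>0"
  proof
    assume "x + of_nat K \<in> \<int>\<^sub>\<le>\<^sub>0"
    then obtain i where "x + of_nat K = - of_nat i" by (auto elim: nonpos_Ints_cases')
    hence "x + of_nat (K + i) = 0" by (simp add: eq_neg_iff_add_eq_0 add.assoc)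
    thus False using x plus_of_nat_eq_0_imp by blast
  qed
  note nz = pochhammer_nonpos_Ints_nonzero [OF x] pochhammer_nonpos_Ints_nonzero [OF xK]
  have 1: "pochhammer (x + of_nat K) n = pochhammer x n * pochhammer (x + of_nat n) K / pochhammer x K"
    using pochhammer_product' [of x n K] pochhammer_product' [of x K n] nz
    by (simp add: field_simps)
  have 2: "pochhammer (x + of_nat K) k = pochhammer x (K + k) / pochhammer x K"
    using pochhammer_product' [of x K k] nz by (simp add: field_simps)
  have 3: "pochhammer (x + of_nat K + \<gamma>) k = pochhammer_nz (x + \<gamma>) (K + k) / pochhammer_nz (x + \<gamma>) K"
    using pochhammer_conv_pochhammer_nz [OF y] by (simp add: add_ac)
  show ?thesis
    unfolding euler_coeff_conv_pochhammer [OF xK] 1 2 3 using nz by (simp add: field_simps)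
qed

theorem corollary3p6:
  fixes m :: nat and n :: "nat \<Rightarrow> nat" and a c d t :: complex and b :: "nat \<Rightarrow> complex"
  defines "N \<equiv> (\<Sum>j=1..m. n j)"
  defines "s \<equiv> (\<lambda>j. \<Sum>i=1..j. n i)"
  defines "\<sigma> \<equiv> (\<lambda>j. a + b j + c + d - 1)"
  defines "C \<equiv> pochhammer (a + c) N * pochhammer (a + d) N *
               (\<Prod>j=1..m. pochhammer (a + b j) (n j))"
  defines "T \<equiv> (\<lambda>k. pochhammer (a - t) k * pochhammer (a + t) k /
                  (pochhammer (a + c) k * pochhammer (a + d) k) *
                  (\<Sum>j=0..k. pochhammer (c + d - 1) (k - j) / fact (k - j) *
                     (pochhammer (1 - c - d - of_nat N) j *
                        (\<Prod>i=1..m. pochhammer (a + b i + of_nat (n i)) j) /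
                      (fact j * (\<Prod>i=1..m. pochhammer (a + b i) j)))))"
  assumes "m \<ge> 1"
    and "2 * a \<notin> \<int>\<^sub>\<le>\<^sub>0" "a + c \<notin> \<int>\<^sub>\<le>\<^sub>0" "a + d \<notin> \<int>\<^sub>\<le>\<^sub>0" "2 * c \<notin> \<int>\<^sub>\<le>\<^sub>0" "c + d \<notin> \<int>\<^sub>\<le>\<^sub>0" "2 * d \<notin> \<int>\<^sub>\<le>\<^sub>0"
    and "\<And>j. j \<in> {1..m} \<Longrightarrow> a + b j \<notin> \<int>\<^sub>\<le>\<^sub>0"
    and "\<And>j. j \<in> {1..m} \<Longrightarrow> 2 * b j \<notin> \<int>\<^sub>\<le>\<^sub>0"
    and "\<And>j. j \<in> {1..m} \<Longrightarrow> b j + c \<notin> \<int>\<^sub>\<le>\<^sub>0"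
    and "\<And>j. j \<in> {1..m} \<Longrightarrow> b j + d \<notin> \<int>\<^sub>\<le>\<^sub>0"
    and "\<And>j. j \<in> {1..m} \<Longrightarrow> a + b j + c + d \<notin> \<int>\<^sub>\<le>\<^sub>0"
    and "\<And>l k. l \<in> {1..m} \<Longrightarrow> k \<in> {1..m} \<Longrightarrow> l \<noteq> k \<Longrightarrow> b l - b k \<notin> \<int>"
  shows "poly (multiple_wilson m n a b c d) (t\<^sup>2) =
           C * (\<Sum>k \<in> (\<Pi>\<^sub>E j\<in>{1..m}. {0..n j}).
             let k' = (\<Sum>j=1..m. k j); K = (\<lambda>i. \<Sum>j=i+1..m. k j) in
             pochhammer (a - t) k' * pochhammer (a + t) k' * pochhammer_nz (\<sigma> 1 + of_nat (n 1)) k' /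
               (pochhammer (a + c) k' * pochhammer (a + d) k' * pochhammer (a + b 1) k') *
             (\<Prod>i=1..m-1.
                pochhammer (a + b i + of_nat (n i)) (K i) *
                  pochhammer_nz (\<sigma> (i + 1) + of_nat (s (i + 1))) (K i) /
                (pochhammer (a + b (i + 1)) (K i) * pochhammer_nz (\<sigma> i + of_nat (s i)) (K i))) *
             (\<Prod>j=1..m. pochhammer (- of_nat (n j)) (k j) / fact (k j)))
       \<and> finite {k. T k \<noteq> 0}
       \<and> poly (multiple_wilson m n a b c d) (t\<^sup>2) = C * (\<Sum>k. T k)"
proof -
  let ?p = "poly (multiple_wilson m n a b c d) (t\<^sup>2)"
  define \<alpha> where "\<alpha> = (\<lambda>j. a + b j - 1)"
  define \<beta> where "\<beta> = c + d - 1"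
  define \<phi> where "\<phi> k = pochhammer (a - t) k * pochhammer (a + t) k /
    (pochhammer (a + c) k * pochhammer (a + d) k)" for k
  define F where "F = (\<Prod>j=1..m. fact (n j) :: complex)"
  define D where "D = pochhammer (a + c) N * pochhammer (a + d) N"
  define B where "B = (\<Prod>j=1..m. pochhammer (a + b j) (n j))"
  note ab = assms(13) and abcd = assms(17)
  have F: "F \<noteq> 0" by (simp add: F_def)
  have B: "B \<noteq> 0" unfolding B_def using pochhammer_nonpos_Ints_nonzero ab by simp
  have C: "C = D * B" by (simp add: C_def D_def B_def)
  obtain P where P: "degree P \<le> N" "fps_of_poly P = jacobi_pineiro_fps m n \<alpha> \<beta>"
    unfolding N_def by (rule jacobi_pineiro_fps_poly)
  have W: "poly (multiple_wilson m n a b c d) (t\<^sup>2) = F * (D * wilson_transform N a c d t P)"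
    using multiple_wilson_eq_transform [OF assms(6) ab abcd P(2) [unfolded \<alpha>_def \<beta>_def], folded N_def]
    unfolding F_def D_def by simp

  \<comment> \<open>the second representation: \<open>P\<close> as a Cauchy product\<close>
  have coeff_P: "coeff P k = B / F * (\<Sum>j=0..k. pochhammer (c + d - 1) (k - j) / fact (k - j) *
      (pochhammer (1 - c - d - of_nat N) j * (\<Prod>i=1..m. pochhammer (a + b i + of_nat (n i)) j) /
        (fact j * (\<Prod>i=1..m. pochhammer (a + b i) j))))" for k
  proof -
    have prod: "(\<Prod>i=1..m. pochhammer (\<alpha> i + 1 + of_nat j) (n i)) =
        B * ((\<Prod>i=1..m. pochhammer (a + b i + of_nat (n i)) j) / (\<Prod>i=1..m. pochhammer (a + b i) j))" for j
    proof -
      have "(\<Prod>i=1..m. pochhammer (\<alpha> i + 1 + of_nat j) (n i)) = (\<Prod>i=1..m. pochhammer (a + b i) (n i) *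
          (pochhammer (a + b i + of_nat (n i)) j / pochhammer (a + b i) j))"
      proof (rule prod.cong [OF refl])
        fix i assume "i \<in> {1..m}"
        note nz = pochhammer_nonpos_Ints_nonzero [OF ab [OF this], of j]
        show "pochhammer (\<alpha> i + 1 + of_nat j) (n i) = pochhammer (a + b i) (n i) *
          (pochhammer (a + b i + of_nat (n i)) j / pochhammer (a + b i) j)"
          using pochhammer_product' [of "a + b i" j "n i"] pochhammer_product' [of "a + b i" "n i" j] nz
          by (simp add: \<alpha>_def field_simps)
      qed
      thus ?thesis by (simp add: B_def prod.distrib prod_dividef)
    qed
    have "fps_of_poly P = fps_const (1 / F) *
        (multi_rodrigues_fps {1..m} n \<alpha> (one_minus_X_powr (of_nat N + \<beta>)) * one_minus_X_powr (- \<beta>))"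
      unfolding P(2) jacobi_pineiro_fps_def F_def N_def by (simp only: mult.commute)
    hence "coeff P k = 1 / F *
        (multi_rodrigues_fps {1..m} n \<alpha> (one_minus_X_powr (of_nat N + \<beta>)) * one_minus_X_powr (- \<beta>)) $ k"
      by (metis fps_of_poly_nth fps_mult_left_const_nth)
    also have "\<dots> = 1 / F * (\<Sum>j=0..k. (\<Prod>i=1..m. pochhammer (\<alpha> i + 1 + of_nat j) (n i)) *
        (pochhammer (- (of_nat N + \<beta>)) j / fact j) * (pochhammer \<beta> (k - j) / fact (k - j)))"
      by (simp add: fps_mult_nth)
    also have "- (of_nat N + \<beta>) = 1 - c - d - of_nat N" by (simp add: \<beta>_def)
    finally show ?thesis
      unfolding prod by (simp add: \<beta>_def sum_distrib_left mult_ac)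
  qed
  have T: "T k = \<phi> k * (F / B * coeff P k)" for k
    unfolding coeff_P T_def \<phi>_def using F B by simp
  have T0: "T k = 0" if "k > N" for k
    using that P(1) by (simp add: T coeff_eq_0)
  hence "{k. T k \<noteq> 0} \<subseteq> {..N}" by (auto simp: not_less [symmetric])
  hence fin: "finite {k. T k \<noteq> 0}" by (rule finite_subset) simp
  have "(\<Sum>k. T k) = (\<Sum>k\<le>N. T k)"
    by (intro suminf_finite) (auto simp: T0)
  also have "\<dots> = F / B * wilson_transform N a c d t P"
    by (simp add: T wilson_transform_def \<phi>_def sum_distrib_left mult_ac)
  finally have second: "?p = C * (\<Sum>k. T k)"
    unfolding W C using B by simp

  \<comment> \<open>the first representation: one application of Euler's transformation for each index\<close>
  define K where "K k i = (\<Sum>j=i+1..m. k j)" for k :: "nat \<Rightarrow> nat" and i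
  define E where "E k = (\<Prod>j=1..m. euler_coeff (n j) (a + b j + of_nat (K k j)) (of_nat (s j) + \<beta>) (k j))" for k
  let ?I = "\<Pi>\<^sub>E j\<in>{1..m}. {0..n j}"
  have "fps_of_poly P = fps_of_poly (\<Sum>k\<in>?I. smult (1 / F * E k) (monom 1 (K k 0)))"
  proof -
    have "multi_rodrigues_fps {1..m} n \<alpha> (one_minus_X_powr (of_nat N + \<beta>)) =
        one_minus_X_powr \<beta> * (\<Sum>k\<in>?I. fps_const (E k) * fps_X ^ K k 0)"
      using multi_rodrigues_fps_expansion [of 0 m n \<alpha> \<beta>]
      by (simp add: N_def E_def K_def s_def \<alpha>_def del: of_nat_sum)
    hence "fps_of_poly P = fps_const (1 / F) * (\<Sum>k\<in>?I. fps_const (E k) * fps_X ^ K k 0)"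
      unfolding P(2) jacobi_pineiro_fps_def F_def [symmetric] N_def [symmetric]
      by (simp only: one_minus_X_powr_cancel)
    thus ?thesis
      by (simp add: fps_of_poly_sum fps_of_poly_smult fps_of_poly_monom sum_distrib_left
          mult.assoc [symmetric])
  qed
  hence P_eq: "P = (\<Sum>k\<in>?I. smult (1 / F * E k) (monom 1 (K k 0)))"
    by (simp add: fps_of_poly_eq_iff)
  have "wilson_transform N a c d t P = (\<Sum>k\<in>?I. 1 / F * E k * \<phi> (K k 0))"
    unfolding P_eq wilson_transform_sum_smult
  proof (intro sum.cong refl)
    fix k assume k: "k \<in> ?I"
    have "K k 0 \<le> N" unfolding K_def N_def using k by (auto intro!: sum_mono simp: PiE_iff)
    thus "1 / F * E k * wilson_transform N a c d t (monom 1 (K k 0)) = 1 / F * E k * \<phi> (K k 0)"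
      by (simp add: wilson_transform_monom \<phi>_def)
  qed
  hence W1: "?p = D * (\<Sum>k\<in>?I. E k * \<phi> (K k 0))"
    unfolding W using F by (simp add: sum_distrib_left mult_ac)
  define R where "R k = (\<Prod>i=1..m-1.
       pochhammer (a + b i + of_nat (n i)) (K k i) *
         pochhammer_nz (\<sigma> (i + 1) + of_nat (s (i + 1))) (K k i) /
       (pochhammer (a + b (i + 1)) (K k i) * pochhammer_nz (\<sigma> i + of_nat (s i)) (K k i)))" for k
  define Q where "Q k = (\<Prod>j=1..m. pochhammer (- of_nat (n j)) (k j) / fact (k j) :: complex)" for k
  have E: "E k = B * (pochhammer_nz (\<sigma> 1 + of_nat (n 1)) (K k 0) / pochhammer (a + b 1) (K k 0) * R k * Q k)"
    if k: "k \<in> ?I" for k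
  proof -
    define f where "f j = pochhammer (a + b j + of_nat (n j)) (K k j) /
      pochhammer_nz (\<sigma> j + of_nat (s j)) (K k j)" for j
    define g where "g j = pochhammer_nz (\<sigma> j + of_nat (s j)) (K k (j - 1)) /
      pochhammer (a + b j) (K k (j - 1))" for j
    have "E k = (\<Prod>j=1..m. pochhammer (a + b j) (n j) *
        (pochhammer (- of_nat (n j)) (k j) / fact (k j)) * (f j * g j))"
      unfolding E_def
    proof (rule prod.cong [OF refl])
      fix j assume j: "j \<in> {1..m}"
      have K: "K k (j - 1) = K k j + k j"
      proof -
        have "{j - 1 + 1..m} = insert j {j + 1..m}" using j by auto
        thus ?thesis unfolding K_def by simp
      qed
      have \<sigma>: "a + b j + (of_nat (s j) + \<beta>) = \<sigma> j + of_nat (s j)"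
        by (simp add: \<sigma>_def \<beta>_def)
      have nz: "a + b j + (of_nat (s j) + \<beta>) + of_nat i \<noteq> 0"
        if i: "K k j \<le> i" "i < K k j + k j" for i
      proof
        assume 0: "a + b j + (of_nat (s j) + \<beta>) + of_nat i = 0"
        \<comment> \<open>\<open>s\<^sub>j + i = 0\<close> would mean \<open>n\<^sub>j = 0\<close>, and the range of \<open>i\<close> would be empty\<close>
        have "s j + i \<ge> 1"
        proof (rule ccontr)
          assume "\<not> ?thesis"
          hence "k j > 0" "s j = 0" using i by auto
          moreover have "k j \<le> n j" using k j by (auto simp: PiE_iff)
          moreover have "n j \<le> s j" using j unfolding s_def by (intro member_le_sum) auto
          ultimately show False by simp
        qed
        hence "a + b j + c + d + of_nat (s j + i - 1) = 0"
          using 0 by (simp add: \<beta>_def of_nat_diff algebra_simps)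
        thus False using abcd [OF j] plus_of_nat_eq_0_imp by blast
      qed
      show "euler_coeff (n j) (a + b j + of_nat (K k j)) (of_nat (s j) + \<beta>) (k j) =
          pochhammer (a + b j) (n j) * (pochhammer (- of_nat (n j)) (k j) / fact (k j)) * (f j * g j)"
        unfolding f_def g_def K \<sigma> [symmetric]
        by (rule euler_coeff_shifted [OF ab [OF j] nz])
    qed
    also have "\<dots> = B * Q k * (\<Prod>j=1..m. f j * g j)"
      by (simp only: prod.distrib B_def Q_def)
    also have "(\<Prod>j=1..m. f j * g j) = f m * g 1 * (\<Prod>i=1..m-1. f i * g (i + 1))"
      using prod_shift_split [of f g "m - 1"] \<open>m \<ge> 1\<close> by simp
    also have "f m = 1" by (simp add: f_def K_def pochhammer_nz_def)
    also have "g 1 = pochhammer_nz (\<sigma> 1 + of_nat (n 1)) (K k 0) / pochhammer (a + b 1) (K k 0)"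
      by (simp add: g_def s_def)
    also have "(\<Prod>i=1..m-1. f i * g (i + 1)) = R k"
      by (simp add: f_def g_def R_def mult_ac)
    finally show ?thesis by (simp only: mult_ac mult_1)
  qed
  have K0: "K k 0 = (\<Sum>j=1..m. k j)" for k by (simp add: K_def)
  have first: "?p = C * (\<Sum>k\<in>?I. \<phi> (K k 0) *
      (pochhammer_nz (\<sigma> 1 + of_nat (n 1)) (K k 0) / pochhammer (a + b 1) (K k 0)) * R k * Q k)"
    unfolding W1 C by (simp add: E sum_distrib_left mult_ac)
  show ?thesis
    unfolding Let_def using first [unfolded \<phi>_def R_def Q_def K0 K_def] fin second
    by simp
qed

end
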